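(* For positive integers $r,s$ let $G_{r,s}$ be the multigraph obtained from the complete graph $K_4$ on $\{a,b,c,d\}$ by replacing the edge $ab$ by $r$ parallel copies and the edge $cd$ by $s$ parallel copies, the other four edges being kept single. Give all edges i.i.d. weights with an atomless law (equivalently uniform on $[0,1]$), and let $T$ be the almost surely unique minimum spanning tree. Let $e$ be one fixed copy of $ab$ and $f$ one fixed copy of $cd$, and put $$R_{r,s}=\frac{\mathbf{P}(e\in T,\ f\in T)}{\mathbf{P}(e\in T)\,\mathbf{P}(f\in T)}.$$ Then for all positive integers $r,s$, $$R_{r,s}\le\frac{78100}{77841}=1.003327\ldots,$$ with equality exactly at $r=s=4$. In the symmetric subfamily, for every positive integer $t$, $$R_{t,t}=\frac{(t+1)^2(t+4)(2t+3)(2t^2+19t+34)}{(2t^3+17t^2+34t+22)^2},$$ $$R_{t,t}-1=\frac{20t^3+9t^2-78t-76}{(2t^3+17t^2+34t+22)^2}=\frac5{t^3}+O(t^{-4})\quad(t\to\infty),$$ so that $t\mapsto R_{t,t}$ is maximal at $t=4$ and tends to $1$ as $t\to\infty$. Moreover $R_{3,3}=109872/109561$.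
   Context: Since the weights are i.i.d. with an atomless law, they are almost surely distinct and the minimum spanning tree is almost surely unique; its law depends only on the (uniform) relative order of the weights. *)

theory Defs
  imports "HOL-Probability.Probability" "HOL-Library.Landau_Symbols"
begin

text \<open>
  A finite undirected multigraph is given by a vertex set \<open>V\<close>, an edge set \<open>E\<close> and a map \<open>ends\<close>
  sending an edge to the set of its end points, so that parallel edges are distinct elements of
  \<open>E\<close> with the same image under \<open>ends\<close>.
\<close>

definition mg_adjacent :: "('e \<Rightarrow> 'v set) \<Rightarrow> 'e set \<Rightarrow> ('v \<times> 'v) set" where
  "mg_adjacent ends F = {(u, v). \<exists>x\<in>F. ends x = {u, v}}"

definition mg_connected :: "'v set \<Rightarrow> ('e \<Rightarrow> 'v set) \<Rightarrow> 'e set \<Rightarrow> bool" where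
  "mg_connected V ends F \<longleftrightarrow> (\<forall>u\<in>V. \<forall>v\<in>V. (u, v) \<in> (mg_adjacent ends F)\<^sup>*)"

text \<open>
  A cycle \<open>v\<^sub>0, x\<^sub>0, v\<^sub>1, x\<^sub>1, \<dots>, v\<^sub>n\<^sub>-\<^sub>1, x\<^sub>n\<^sub>-\<^sub>1, v\<^sub>0\<close> has distinct vertices and distinct edges.  The
  length 2 is allowed (two distinct parallel edges), and so is the length 1 (a loop).
\<close>

definition mg_cycle :: "('e \<Rightarrow> 'v set) \<Rightarrow> 'e set \<Rightarrow> 'v list \<Rightarrow> 'e list \<Rightarrow> bool" where
  "mg_cycle ends F vs xs \<longleftrightarrow>
     vs \<noteq> [] \<and> length xs = length vs \<and> distinct vs \<and> distinct xs \<and> set xs \<subseteq> F \<and>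
     (\<forall>i<length vs. ends (xs ! i) = {vs ! i, vs ! (Suc i mod length vs)})"

definition mg_acyclic :: "('e \<Rightarrow> 'v set) \<Rightarrow> 'e set \<Rightarrow> bool" where
  "mg_acyclic ends F \<longleftrightarrow> (\<nexists>vs xs. mg_cycle ends F vs xs)"

definition mg_spanning_tree :: "'v set \<Rightarrow> 'e set \<Rightarrow> ('e \<Rightarrow> 'v set) \<Rightarrow> 'e set \<Rightarrow> bool" where
  "mg_spanning_tree V E ends T \<longleftrightarrow> T \<subseteq> E \<and> mg_connected V ends T \<and> mg_acyclic ends T"

definition is_mst :: "'v set \<Rightarrow> 'e set \<Rightarrow> ('e \<Rightarrow> 'v set) \<Rightarrow> ('e \<Rightarrow> real) \<Rightarrow> 'e set \<Rightarrow> bool" where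
  "is_mst V E ends w T \<longleftrightarrow>
     mg_spanning_tree V E ends T \<and>
     (\<forall>T'. mg_spanning_tree V E ends T' \<longrightarrow> sum w T \<le> sum w T')"

text \<open>Only meaningful for weights \<open>w\<close> that have exactly one minimum spanning tree.\<close>

definition mst :: "'v set \<Rightarrow> 'e set \<Rightarrow> ('e \<Rightarrow> 'v set) \<Rightarrow> ('e \<Rightarrow> real) \<Rightarrow> 'e set" where
  "mst V E ends w = (THE T. is_mst V E ends w T)"

text \<open>
  An edge of \<open>G\<^sub>r\<^sub>,\<^sub>s\<close> is a pair of an edge of \<open>K\<^sub>4\<close> (a 2-element set of vertices) and the index of
  a copy of that edge; its end points are given by \<^const>\<open>fst\<close>.
\<close>

datatype vertex = Va | Vb | Vc | Vd

definition K4_edges :: "vertex set set" where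
  "K4_edges = {p. card p = 2}"

definition multiplicity_G :: "nat \<Rightarrow> nat \<Rightarrow> vertex set \<Rightarrow> nat" where
  "multiplicity_G r s p = (if p = {Va, Vb} then r else if p = {Vc, Vd} then s else 1)"

definition edges_G :: "nat \<Rightarrow> nat \<Rightarrow> (vertex set \<times> nat) set" where
  "edges_G r s = {(p, i). p \<in> K4_edges \<and> i < multiplicity_G r s p}"

abbreviation is_mst_G :: "nat \<Rightarrow> nat \<Rightarrow> (vertex set \<times> nat \<Rightarrow> real) \<Rightarrow> (vertex set \<times> nat) set \<Rightarrow> bool" where
  "is_mst_G r s \<equiv> is_mst UNIV (edges_G r s) fst"

abbreviation mst_G :: "nat \<Rightarrow> nat \<Rightarrow> (vertex set \<times> nat \<Rightarrow> real) \<Rightarrow> (vertex set \<times> nat) set" where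
  "mst_G r s \<equiv> mst UNIV (edges_G r s) fst"

definition iid_atomless :: "'w measure \<Rightarrow> 'e set \<Rightarrow> ('e \<Rightarrow> 'w \<Rightarrow> real) \<Rightarrow> bool" where
  "iid_atomless M E X \<longleftrightarrow>
     prob_space M \<and> prob_space.indep_vars M (\<lambda>_. borel) X E \<and>
     (\<exists>\<mu>. (\<forall>x\<in>E. distr M borel (X x) = \<mu>) \<and> (\<forall>y. emeasure \<mu> {y} = 0))"

definition mst_ratio ::
  "'w measure \<Rightarrow> nat \<Rightarrow> nat \<Rightarrow> (vertex set \<times> nat \<Rightarrow> 'w \<Rightarrow> real) \<Rightarrow>
   vertex set \<times> nat \<Rightarrow> vertex set \<times> nat \<Rightarrow> real" where
  "mst_ratio M r s X e f =
     (let T = (\<lambda>\<omega>. mst_G r s (\<lambda>x. X x \<omega>)) in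
        measure M {\<omega> \<in> space M. e \<in> T \<omega> \<and> f \<in> T \<omega>} /
        (measure M {\<omega> \<in> space M. e \<in> T \<omega>} * measure M {\<omega> \<in> space M. f \<in> T \<omega>}))"

end

(*
  For distinct weights an edge lies in the minimum spanning tree iff it is the lightest edge of some
  cut.  In K_4 with multiplied edges ab and cd there are four cuts separating the ends of e, so both
  events become Boolean combinations of "e is lightest in S" and "f is lightest in U" for unions S, U
  of parallel classes.  By exchangeability of i.i.d. weights these have probability 1/|S|, and jointly
  1/(|S||U|) when S is a subset of U - {f}; the joint event reduces to nested sets after splitting
  according to which of e, f is lighter.  With n = r + s this gives
    P(e in T) = 2/(r+2) - 1/(r+4) + 2/(n+2) - 4/(n+3) + 2/(n+4)
  and a similar joint probability.  The bound becomes a polynomial inequality; shifting the variables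
  by their values near the maximum makes all coefficients nonnegative, up to finitely many (r, s).
*)

theory Submission
  imports Defs "HOL-Real_Asymp.Real_Asymp"
begin

section \<open>Minimum spanning trees and cuts\<close>

text \<open>Two obstacles shape the argument. First, the events for \<open>e\<close> and
  \<open>f\<close> are not nested as they stand. If \<open>f\<close> is lighter than
  \<open>e\<close>, then \<open>e\<close> cannot be lightest in a cut through the class
  \<open>cd\<close>, so its cut \<open>S\<close> is the star of \<open>a\<close> or of
  \<open>b\<close>. As \<open>f\<close> then beats all of \<open>S\<close>, the requirements that
  \<open>f\<close> be lighter than \<open>e\<close> and lightest in its own cut \<open>U\<close>
  amount to \<open>f\<close> being lightest in the union of \<open>S\<close> and \<open>U\<close>.
  This union contains \<open>S\<close>, while \<open>f\<close> lies outside \<open>S\<close>.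
  Second, the bound is arithmetic rather than analytic: extended to positive reals, the ratio
  exceeds 78100/77841 just below (4, 4), because the inequality with denominators cleared has a
  nonzero gradient there. So (4, 4) is not a critical point; it serves as the corner of a quadrant,
  and the rows 1, 2, 3 need separate treatment.\<close>

abbreviation mg_reach :: "('e \<Rightarrow> 'v set) \<Rightarrow> 'e set \<Rightarrow> 'v \<Rightarrow> 'v \<Rightarrow> bool" where
  "mg_reach ends F u v \<equiv> (u, v) \<in> (mg_adjacent ends F)\<^sup>*"

lemma mg_adjacent_sym: "(u, v) \<in> mg_adjacent ends F \<Longrightarrow> (v, u) \<in> mg_adjacent ends F"
  by (auto simp: mg_adjacent_def insert_commute)

lemma mg_reach_sym: "mg_reach ends F u v \<Longrightarrow> mg_reach ends F v u"
  by (rule symD[OF sym_rtrancl]) (auto intro: symI mg_adjacent_sym)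

lemma mg_reach_mono: "F \<subseteq> F' \<Longrightarrow> mg_reach ends F u v \<Longrightarrow> mg_reach ends F' u v"
  by (erule rtrancl_mono[THEN subsetD, rotated]) (auto simp: mg_adjacent_def)

lemma mg_reach_edge: "x \<in> F \<Longrightarrow> ends x = {u, v} \<Longrightarrow> mg_reach ends F u v"
  by (auto simp: mg_adjacent_def)

text \<open>Only the parts of a walk before the first and after the last use of \<open>x\<close>
  matter, so \<open>x\<close> need be crossed at most once, in one of two directions.\<close>

lemma mg_reach_insert:
  assumes "mg_reach ends (insert x F) a b" "ends x = {u, v}"
  shows "mg_reach ends F a b \<or> (mg_reach ends F a u \<and> mg_reach ends F v b) \<or>
    (mg_reach ends F a v \<and> mg_reach ends F u b)"
  using assms(1)
proof (induction rule: rtrancl_induct)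
  case (step b c)
  have "(b, c) \<in> mg_adjacent ends F \<or> {b, c} = {u, v}"
    using step.hyps(2) assms(2) by (auto simp: mg_adjacent_def)
  thus ?case
    using step.IH by (auto simp: doubleton_eq_iff intro: rtrancl.rtrancl_into_rtrancl)
qed simp

text \<open>Applied in contrapositive form: a walk from \<open>U\<close> to a vertex outside has an
  edge leaving \<open>U\<close>.\<close>

lemma mg_reach_closed:
  assumes "mg_reach ends F u v" "u \<in> U"
    and "\<And>x p q. x \<in> F \<Longrightarrow> ends x = {p, q} \<Longrightarrow> p \<in> U \<Longrightarrow> q \<in> U"
  shows "v \<in> U"
  using assms(1,2) by (induction rule: rtrancl_induct) (auto simp: mg_adjacent_def assms(3))

lemma mg_connected_mono: "F \<subseteq> F' \<Longrightarrow> mg_connected V ends F \<Longrightarrow> mg_connected V ends F'"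
  by (simp add: mg_connected_def mg_reach_mono)

lemma mg_connected_redundant_edge:
  assumes "mg_connected V ends (insert x F)" "ends x = {u, v}" "mg_reach ends F u v"
  shows "mg_connected V ends F"
  unfolding mg_connected_def
proof (intro ballI)
  fix a b assume "a \<in> V" "b \<in> V"
  hence "mg_reach ends (insert x F) a b" using assms(1) by (auto simp: mg_connected_def)
  from mg_reach_insert[OF this assms(2)] show "mg_reach ends F a b"
    using assms(3) mg_reach_sym[OF assms(3)] by (meson rtrancl_trans)
qed

text \<open>If \<open>C\<close> is disconnected and one more edge \<open>y\<close> connects it, then it has two components and
  \<open>y\<close> runs between them.\<close>

lemma mg_connected_exchange:
  assumes "mg_connected V ends (insert y C)" "\<not> mg_connected V ends (insert x C)"
    and "ends y = {u, v}" "ends x = {p, q}" "p \<in> V" "q \<in> V" "u \<in> V" "v \<in> V"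
  shows "mg_reach ends C p q"
proof (rule ccontr)
  assume npq: "\<not> mg_reach ends C p q"
  have "mg_reach ends (insert y C) p q" using assms by (auto simp: mg_connected_def)
  from mg_reach_insert[OF this assms(3)] npq
  have pq: "(mg_reach ends C p u \<and> mg_reach ends C v q) \<or> (mg_reach ends C p v \<and> mg_reach ends C u q)"
    by blast
  \<comment> \<open>The walk from \<open>p\<close> to \<open>q\<close> has to use \<open>y\<close>;
    its two remaining parts, joined by \<open>x\<close>, lead around \<open>y\<close>.\<close>
  have "mg_reach ends (insert x C) u v"
  proof -
    have m: "mg_reach ends (insert x C) a b" if "mg_reach ends C a b" for a b
      by (rule mg_reach_mono[OF _ that]) auto
    have "mg_reach ends (insert x C) p q" by (rule mg_reach_edge) (use assms(4) in auto)
    thus ?thesis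
      using pq m mg_reach_sym by (meson rtrancl_trans)
  qed
  moreover have "mg_connected V ends (insert y (insert x C))"
    by (rule mg_connected_mono[OF _ assms(1)]) auto
  ultimately have "mg_connected V ends (insert x C)"
    using assms(3) mg_connected_redundant_edge by metis
  thus False using assms(2) by simp
qed

text \<open>With this description of trees, exchange arguments concern reachability alone; cycles
  occur only in showing that it is equivalent.\<close>

definition mg_min_connected :: "'v set \<Rightarrow> ('e \<Rightarrow> 'v set) \<Rightarrow> 'e set \<Rightarrow> bool" where
  "mg_min_connected V ends T \<longleftrightarrow>
     mg_connected V ends T \<and> (\<forall>x\<in>T. \<not> mg_connected V ends (T - {x}))"

text \<open>The other edges of a cycle still join the ends of \<open>x\<close>, so \<open>x\<close>
  could be deleted.\<close>

lemma mg_min_connected_acyclic: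
  assumes "mg_min_connected V ends T"
  shows "mg_acyclic ends T"
  unfolding mg_acyclic_def
proof (intro notI, elim exE)
  fix vs xs assume c: "mg_cycle ends T vs xs"
  define n where "n = length vs"
  have n: "n > 0" "length xs = n" "distinct xs" "set xs \<subseteq> T"
    and e: "\<And>i. i < n \<Longrightarrow> ends (xs ! i) = {vs ! i, vs ! (Suc i mod n)}"
    using c by (auto simp: mg_cycle_def n_def)
  define x where "x = xs ! 0"
  have xT: "x \<in> T" using n by (auto simp: x_def)
  \<comment> \<open>For a loop, \<open>n = 1\<close> and \<open>1 mod n\<close> is 0: the rest of
    the cycle is empty.\<close>
  have r: "mg_reach ends (T - {x}) (vs ! (1 mod n)) (vs ! (Suc k mod n))" if "k < n" for k
    using that
  proof (induction k)
    case (Suc k)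
    have "xs ! Suc k \<in> T - {x}"
      using Suc.prems n by (auto simp: x_def nth_eq_iff_index_eq)
    moreover have "ends (xs ! Suc k) = {vs ! (Suc k mod n), vs ! (Suc (Suc k) mod n)}"
      using e[OF Suc.prems] Suc.prems by simp
    ultimately have "mg_reach ends (T - {x}) (vs ! (Suc k mod n)) (vs ! (Suc (Suc k) mod n))"
      by (rule mg_reach_edge)
    with Suc show ?case by (meson Suc_lessD rtrancl_trans)
  qed simp
  have "mg_reach ends (T - {x}) (vs ! (1 mod n)) (vs ! 0)"
    using r[of "n - 1"] n by simp
  moreover have "ends x = {vs ! (1 mod n), vs ! 0}"
    using e[of 0] n by (auto simp: x_def)
  moreover have "mg_connected V ends (insert x (T - {x}))"
    using assms xT by (simp add: mg_min_connected_def insert_absorb)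
  ultimately have "mg_connected V ends (T - {x})"
    by (metis mg_connected_redundant_edge)
  thus False using assms xT by (simp add: mg_min_connected_def)
qed

text \<open>A shortest walk from \<open>u\<close> to \<open>v\<close> avoiding \<open>x\<close>
  becomes a cycle when closed by \<open>x\<close>.\<close>

lemma mg_acyclic_no_reach:
  assumes "mg_acyclic ends T" "x \<in> T" "ends x = {u, v}" "u \<noteq> v"
  shows "\<not> mg_reach ends (T - {x}) u v"
proof
  let ?R = "mg_adjacent ends (T - {x})"
  assume "mg_reach ends (T - {x}) u v"
  then obtain n0 where "(u, v) \<in> ?R ^^ n0" by (auto simp: rtrancl_power)
  define n where "n = (LEAST n. (u, v) \<in> ?R ^^ n)"
  have nR: "(u, v) \<in> ?R ^^ n" unfolding n_def by (rule LeastI) fact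
  have nmin: "n \<le> m" if "(u, v) \<in> ?R ^^ m" for m unfolding n_def by (rule Least_le) fact
  from nR obtain g where g: "g 0 = u" "g n = v" "\<And>i. i < n \<Longrightarrow> (g i, g (Suc i)) \<in> ?R"
    by (auto simp: relpow_fun_conv)
  have sub: "(g i, g j) \<in> ?R ^^ (j - i)" if "i \<le> j" "j \<le> n" for i j
    using that g(3) by (auto simp: relpow_fun_conv intro!: exI[of _ "\<lambda>k. g (i + k)"])
  \<comment> \<open>A segment between two visits to one vertex could be cut out, against the choice
    of \<open>n\<close>.\<close>
  have neq: "g i \<noteq> g j" if ij: "i < j" "j \<le> n" for i j
  proof
    assume eq: "g i = g j"
    have "(u, g i) \<in> ?R ^^ i" "(g i, v) \<in> ?R ^^ (n - j)"
      using sub[of 0 i] sub[of j n] ij g eq by auto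
    hence "(u, v) \<in> ?R ^^ (i + (n - j))" by (auto simp: relpow_add)
    from nmin[OF this] ij show False by simp
  qed
  hence ginj: "g i = g j \<longleftrightarrow> i = j" if "i \<le> n" "j \<le> n" for i j
    using that by (metis linorder_neqE_nat)
  have "\<forall>i. \<exists>y. i < n \<longrightarrow> y \<in> T - {x} \<and> ends y = {g i, g (Suc i)}"
    using g(3) by (auto simp: mg_adjacent_def)
  then obtain h where h: "\<And>i. i < n \<Longrightarrow> h i \<in> T - {x} \<and> ends (h i) = {g i, g (Suc i)}"
    by metis
  have hinj: "i = j" if "i < n" "j < n" "h i = h j" for i j
  proof -
    have "{g i, g (Suc i)} = {g j, g (Suc j)}" using h that by metis
    thus ?thesis using ginj that by (auto simp: doubleton_eq_iff)
  qed
  define vs where "vs = map g [0..<Suc n]"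
  define xs where "xs = map h [0..<n] @ [x]"
  have "mg_cycle ends T vs xs"
    unfolding mg_cycle_def
  proof (intro conjI allI impI)
    show "vs \<noteq> []" "length xs = length vs" by (auto simp: vs_def xs_def)
    show "distinct vs" using ginj by (auto simp: vs_def distinct_map inj_on_def simp del: upt_Suc)
    show "distinct xs" using hinj h by (fastforce simp: xs_def distinct_map inj_on_def)
    show "set xs \<subseteq> T" using h assms(2) by (auto simp: xs_def)
    fix i assume "i < length vs"
    hence "i < n \<or> i = n" by (auto simp: vs_def)
    thus "ends (xs ! i) = {vs ! i, vs ! (Suc i mod length vs)}"
    proof
      assume "i < n"
      thus ?thesis using h[of i] by (simp add: vs_def xs_def nth_append del: upt_Suc)
    next
      assume "i = n"
      thus ?thesis using assms(3) g
        by (simp add: vs_def xs_def nth_append insert_commute del: upt_Suc)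
    qed
  qed
  thus False using assms(1) by (auto simp: mg_acyclic_def)
qed

section \<open>Spanning trees of a finite connected multigraph and edge exchange\<close>

locale multigraph =
  fixes V :: "'v set" and E :: "'e set" and ends :: "'e \<Rightarrow> 'v set"
  assumes finite_E: "finite E"
    and ends_E: "x \<in> E \<Longrightarrow> ends x \<subseteq> V \<and> card (ends x) = 2"
    and connected_E: "mg_connected V ends E"
begin

lemma endsE:
  assumes "x \<in> E" obtains u v where "ends x = {u, v}" "u \<noteq> v" "u \<in> V" "v \<in> V"
  using ends_E[OF assms] that by (metis card_2_iff insert_subset)

lemma spanning_tree_iff_min_connected:
  "mg_spanning_tree V E ends T \<longleftrightarrow> T \<subseteq> E \<and> mg_min_connected V ends T"
proof
  assume T: "mg_spanning_tree V E ends T"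
  have "\<not> mg_connected V ends (T - {x})" if "x \<in> T" for x
  proof -
    have "x \<in> E" using T that by (auto simp: mg_spanning_tree_def)
    then obtain u v where uv: "ends x = {u, v}" "u \<noteq> v" "u \<in> V" "v \<in> V" by (rule endsE)
    have "\<not> mg_reach ends (T - {x}) u v"
      by (rule mg_acyclic_no_reach) (use T that uv in \<open>auto simp: mg_spanning_tree_def\<close>)
    thus ?thesis using uv by (auto simp: mg_connected_def)
  qed
  thus "T \<subseteq> E \<and> mg_min_connected V ends T"
    using T by (auto simp: mg_spanning_tree_def mg_min_connected_def)
next
  assume "T \<subseteq> E \<and> mg_min_connected V ends T"
  thus "mg_spanning_tree V E ends T"
    using mg_min_connected_acyclic[of V ends T]
    by (auto simp: mg_spanning_tree_def mg_min_connected_def)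
qed

text \<open>Minimality is the point. If some \<open>x\<close> other than \<open>e\<close> became
  redundant, then \<open>C\<close>, the tree without \<open>g\<close> and \<open>x\<close>, would be
  connected by adding \<open>e\<close> but not by adding \<open>g\<close>. Hence \<open>C\<close>
  joins the ends of \<open>g\<close>, so \<open>g\<close> was already redundant in
  \<open>T\<close>.\<close>

lemma spanning_tree_exchange:
  assumes T: "mg_spanning_tree V E ends T" and g: "g \<in> T" and e: "e \<in> E" "e \<notin> T"
    and con: "mg_connected V ends (insert e (T - {g}))"
  shows "mg_spanning_tree V E ends (insert e (T - {g}))"
proof -
  have TE: "T \<subseteq> E" and min: "mg_connected V ends T"
    "\<And>x. x \<in> T \<Longrightarrow> \<not> mg_connected V ends (T - {x})"
    using T by (auto simp: spanning_tree_iff_min_connected mg_min_connected_def)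
  obtain u v where uv: "ends e = {u, v}" "u \<in> V" "v \<in> V" using endsE[OF e(1)] by metis
  have "\<not> mg_connected V ends (insert e (T - {g}) - {x})" if x: "x \<in> insert e (T - {g})" for x
  proof (cases "x = e")
    case True
    hence "insert e (T - {g}) - {x} = T - {g}" using e by auto
    thus ?thesis using min g by simp
  next
    case False
    define C where "C = T - {g} - {x}"
    have xT: "x \<in> T" "x \<noteq> g" using x False by auto
    have eqs: "insert e (T - {g}) - {x} = insert e C" "insert x C = T - {g}"
      "insert g C = T - {x}" "insert g (insert x C) = T"
      using xT False g by (auto simp: C_def)
    obtain p q where pq: "ends x = {p, q}" "p \<in> V" "q \<in> V" using endsE[of x] xT TE by (metis subsetD)
    obtain p' q' where pq': "ends g = {p', q'}" "p' \<in> V" "q' \<in> V" using endsE[of g] g TE by (metis subsetD)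
    show ?thesis
    proof
      assume "mg_connected V ends (insert e (T - {g}) - {x})"
      hence c: "mg_connected V ends (insert e C)" using eqs by simp
      have "mg_reach ends C p' q'"
        using mg_connected_exchange[of V ends e C g u v p' q'] c uv pq' eqs min xT by auto
      hence "mg_reach ends (insert x C) p' q'" by (rule mg_reach_mono[rotated]) auto
      hence "mg_connected V ends (insert x C)"
        using mg_connected_redundant_edge[of V ends g "insert x C" p' q'] pq'(1) eqs min by simp
      thus False using eqs min g by simp
    qed
  qed
  thus ?thesis
    using con TE e by (auto simp: spanning_tree_iff_min_connected mg_min_connected_def)
qed

lemma is_mst_exchange_le:
  assumes "is_mst V E ends w T" "g \<in> T" "e \<in> E" "e \<notin> T"
    and "mg_connected V ends (insert e (T - {g}))"
  shows "w g \<le> w e"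
proof -
  have T: "mg_spanning_tree V E ends T" using assms(1) by (simp add: is_mst_def)
  have "finite T" using T finite_E by (auto simp: mg_spanning_tree_def intro: finite_subset)
  hence "sum w (insert e (T - {g})) = w e + (sum w T - w g)"
    using assms by (simp add: sum_diff1)
  moreover have "sum w T \<le> sum w (insert e (T - {g}))"
    using assms(1) spanning_tree_exchange[OF T assms(2-5)] by (auto simp: is_mst_def)
  ultimately show ?thesis by simp
qed

lemma ex_is_mst: "\<exists>T. is_mst V E ends w T"
proof -
  let ?S = "{T. T \<subseteq> E \<and> mg_connected V ends T}"
  have "finite ?S" using finite_E by simp
  from finite_has_minimal2[OF this, of E] connected_E
  obtain T where T: "T \<in> ?S" "\<And>T'. T' \<in> ?S \<Longrightarrow> T' \<subseteq> T \<Longrightarrow> T = T'" by auto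
  have "\<not> mg_connected V ends (T - {x})" if "x \<in> T" for x
    using T(2)[of "T - {x}"] T(1) that by auto
  hence "mg_spanning_tree V E ends T"
    using T(1) by (auto simp: spanning_tree_iff_min_connected mg_min_connected_def)
  moreover have "finite {T. mg_spanning_tree V E ends T}"
    by (rule finite_subset[of _ "Pow E"]) (auto simp: finite_E mg_spanning_tree_def)
  ultimately obtain T0 where "is_arg_min (sum w) (mg_spanning_tree V E ends) T0"
    using ex_is_arg_min_if_finite[of "{T. mg_spanning_tree V E ends T}" "sum w"] by auto
  thus ?thesis by (auto simp: is_mst_def is_arg_min_linorder)
qed

section \<open>The cut criterion for membership in the minimum spanning tree\<close>

definition cut :: "'v set \<Rightarrow> 'e set" where
  "cut U = {x \<in> E. \<exists>u v. ends x = {u, v} \<and> u \<in> U \<and> v \<notin> U}"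

text \<open>The witness is the component of one end of \<open>e\<close> in \<open>T - {e}\<close>.
  Every edge leaving it reconnects the tree, so it could replace \<open>e\<close> and cannot be
  lighter.\<close>

lemma mem_is_mst_imp_lightest_in_cut:
  assumes T: "is_mst V E ends w T" and e: "e \<in> T"
  shows "\<exists>U. e \<in> cut U \<and> (\<forall>g\<in>cut U. w e \<le> w g)"
proof -
  have TE: "T \<subseteq> E" and con: "mg_connected V ends T" and ncon: "\<not> mg_connected V ends (T - {e})"
    using T e by (auto simp: is_mst_def spanning_tree_iff_min_connected mg_min_connected_def)
  have T_eq: "insert e (T - {e}) = T" using e by auto
  obtain u v where uv: "ends e = {u, v}" "u \<in> V" "v \<in> V" using endsE[of e] e TE by (metis subsetD)
  define U where "U = {z. mg_reach ends (T - {e}) u z}"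
  have "v \<notin> U"
    using mg_connected_redundant_edge[of V ends e "T - {e}" u v] uv T_eq con ncon by (auto simp: U_def)
  hence "e \<in> cut U" using uv e TE by (auto simp: cut_def U_def)
  moreover have "w e \<le> w g" if g: "g \<in> cut U" for g
  proof (cases "g = e")
    case False
    obtain p q where pq: "g \<in> E" "ends g = {p, q}" "p \<in> U" "q \<notin> U" using g by (auto simp: cut_def)
    have V: "p \<in> V" "q \<in> V" using ends_E[OF pq(1)] pq(2) by auto
    have nr: "\<not> mg_reach ends (T - {e}) p q"
      using pq(3,4) unfolding U_def by (meson mem_Collect_eq rtrancl_trans)
    hence gT: "g \<notin> T" using False mg_reach_edge[of g "T - {e}" ends p q] pq by auto
    have "mg_connected V ends (insert g (T - {e}))"
    proof (rule ccontr)
      assume "\<not> ?thesis"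
      with mg_connected_exchange[of V ends e "T - {e}" g u v p q] uv pq V T_eq con nr show False by simp
    qed
    thus ?thesis using is_mst_exchange_le[OF T e pq(1) gT] by simp
  qed simp
  ultimately show ?thesis by blast
qed

text \<open>A set \<open>P\<close> of tree edges that is minimal among those joining the ends of \<open>e\<close> plays the role
  of the tree path between them.\<close>

lemma lightest_in_cut_imp_mem_is_mst:
  assumes T: "is_mst V E ends w T" and e: "e \<in> cut U"
    and less: "\<And>g. g \<in> cut U \<Longrightarrow> g \<noteq> e \<Longrightarrow> w e < w g"
  shows "e \<in> T"
proof (rule ccontr)
  assume eT: "e \<notin> T"
  obtain u v where uv: "e \<in> E" "ends e = {u, v}" "u \<in> U" "v \<notin> U" using e by (auto simp: cut_def)
  have V: "u \<in> V" "v \<in> V" using ends_E[OF uv(1)] uv(2) by auto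
  have TE: "T \<subseteq> E" and con: "mg_connected V ends T"
    and ncon: "\<And>x. x \<in> T \<Longrightarrow> \<not> mg_connected V ends (T - {x})"
    using T by (auto simp: is_mst_def spanning_tree_iff_min_connected mg_min_connected_def)
  let ?S = "{P. P \<subseteq> T \<and> mg_reach ends P u v}"
  have "finite ?S" using finite_subset[OF TE finite_E] by simp
  moreover have "T \<in> ?S" using con V by (auto simp: mg_connected_def)
  ultimately obtain P where P: "P \<subseteq> T" "mg_reach ends P u v"
    and Pmin: "\<And>P'. P' \<subseteq> P \<Longrightarrow> mg_reach ends P' u v \<Longrightarrow> P' = P"
  proof -
    obtain P where "P \<in> ?S" "\<forall>P'\<in>?S. P' \<subseteq> P \<longrightarrow> P = P'"
      using finite_has_minimal2[OF \<open>finite ?S\<close> \<open>T \<in> ?S\<close>] by auto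
    thus ?thesis by (intro that[of P]) auto
  qed
  obtain g p q where g: "g \<in> P" "ends g = {p, q}" "p \<in> U" "q \<notin> U"
    using mg_reach_closed[OF P(2) uv(3)] uv(4) by blast
  have gT: "g \<in> T" and gcut: "g \<in> cut U" using g P TE by (auto simp: cut_def)
  have T_eq: "insert g (T - {g}) = T" and P_eq: "insert g (P - {g}) = P" using gT g by auto
  \<comment> \<open>Minimality of \<open>P\<close> forces its walk through \<open>g\<close>, so
    \<open>P - {g}\<close> together with \<open>e\<close> joins the ends of \<open>g\<close>, and
    \<open>g\<close> can be exchanged for the lighter \<open>e\<close>.\<close>
  have "\<not> mg_reach ends (P - {g}) u v" using Pmin[of "P - {g}"] g by auto
  with mg_reach_insert[of u v ends g "P - {g}" p q] g(2) P(2) P_eq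
  have "(mg_reach ends (P - {g}) u p \<and> mg_reach ends (P - {g}) q v) \<or>
      (mg_reach ends (P - {g}) u q \<and> mg_reach ends (P - {g}) p v)" by auto
  moreover have "mg_reach ends (insert e (T - {g})) a b" if "mg_reach ends (P - {g}) a b" for a b
    by (rule mg_reach_mono[OF _ that]) (use P in auto)
  moreover have "mg_reach ends (insert e (T - {g})) u v"
    by (rule mg_reach_edge) (use uv(2) in auto)
  ultimately have pq: "mg_reach ends (insert e (T - {g})) p q"
    by (meson mg_reach_sym rtrancl_trans)
  have "mg_connected V ends (insert g (insert e (T - {g})))"
    by (rule mg_connected_mono[OF _ con]) auto
  hence "mg_connected V ends (insert e (T - {g}))"
    using g(2) pq mg_connected_redundant_edge by metis
  from is_mst_exchange_le[OF T gT uv(1) eT this] less[OF gcut] gT eT show False by fastforce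
qed

text \<open>Being strictly lightest in some cut does not mention the tree, so with distinct weights
  any two minimum spanning trees contain each other.\<close>

lemma ex1_is_mst:
  assumes "inj_on w E"
  shows "\<exists>!T. is_mst V E ends w T"
proof -
  have sub: "e \<in> T'" if T: "is_mst V E ends w T" "is_mst V E ends w T'" and e: "e \<in> T" for e T T'
  proof -
    obtain U where U: "e \<in> cut U" "\<And>g. g \<in> cut U \<Longrightarrow> w e \<le> w g"
      using mem_is_mst_imp_lightest_in_cut[OF T(1) e] by blast
    moreover have "w e \<noteq> w g" if "g \<in> cut U" "g \<noteq> e" for g
      using inj_onD[OF assms, of e g] that U(1) by (auto simp: cut_def)
    ultimately show ?thesis
      using lightest_in_cut_imp_mem_is_mst[OF T(2) U(1)] by (metis order_le_less)
  qed
  obtain T where "is_mst V E ends w T" using ex_is_mst by blast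
  thus ?thesis using sub by (intro ex1I[of _ T]) (auto dest: sub)
qed

lemma mem_mst_iff_lightest_in_cut:
  assumes "inj_on w E"
  shows "e \<in> mst V E ends w \<longleftrightarrow> (\<exists>U. e \<in> cut U \<and> (\<forall>g\<in>cut U - {e}. w e < w g))"
proof -
  have T: "is_mst V E ends w (mst V E ends w)"
    unfolding mst_def by (rule theI'[OF ex1_is_mst[OF assms]])
  show ?thesis
  proof
    assume "e \<in> mst V E ends w"
    then obtain U where U: "e \<in> cut U" "\<And>g. g \<in> cut U \<Longrightarrow> w e \<le> w g"
      using mem_is_mst_imp_lightest_in_cut[OF T] by blast
    moreover have "w e \<noteq> w g" if "g \<in> cut U" "g \<noteq> e" for g
      using inj_onD[OF assms, of e g] that U(1) by (auto simp: cut_def)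
    ultimately show "\<exists>U. e \<in> cut U \<and> (\<forall>g\<in>cut U - {e}. w e < w g)"
      by (metis DiffE insertCI order_le_less)
  next
    assume "\<exists>U. e \<in> cut U \<and> (\<forall>g\<in>cut U - {e}. w e < w g)"
    thus "e \<in> mst V E ends w" using lightest_in_cut_imp_mem_is_mst[OF T] by blast
  qed
qed

end

section \<open>Exchangeable weights\<close>

locale iid_weights = prob_space M for M :: "'w measure" +
  fixes E :: "'e set" and X :: "'e \<Rightarrow> 'w \<Rightarrow> real"
  assumes finite_edges: "finite E" and nonempty_edges: "E \<noteq> {}"
    and iid: "iid_atomless M E X"
begin

lemma indep_X: "indep_vars (\<lambda>_. borel) X E"
  using iid by (simp add: iid_atomless_def)

lemma measurable_X [measurable]: "x \<in> E \<Longrightarrow> X x \<in> borel_measurable M"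
  using indep_X by (auto simp: indep_vars_def)

definition weight_law :: "real measure" where
  "weight_law = distr M borel (X (SOME x. x \<in> E))"

lemma distr_X: "x \<in> E \<Longrightarrow> distr M borel (X x) = weight_law"
  using iid some_in_eq[of E] unfolding iid_atomless_def weight_law_def by (metis empty_iff)

lemma emeasure_weight_law_singleton: "emeasure weight_law {y} = 0"
  using iid distr_X nonempty_edges unfolding iid_atomless_def by (metis ex_in_conv)

lemma sets_weight_law [simp, measurable_cong]: "sets weight_law = sets borel"
  by (simp add: weight_law_def)

lemma prob_space_weight_law: "prob_space weight_law"
  using nonempty_edges distr_X measurable_X prob_space_distr by (metis ex_in_conv)

lemma distr_weights:
  "distr M (PiM E (\<lambda>_. borel)) (\<lambda>\<omega>. \<lambda>x\<in>E. X x \<omega>) = PiM E (\<lambda>_. weight_law)"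
proof -
  have "distr M (PiM E (\<lambda>_. borel)) (\<lambda>\<omega>. \<lambda>x\<in>E. X x \<omega>) = PiM E (\<lambda>x. distr M borel (X x))"
    using indep_X indep_vars_iff_distr_eq_PiM'[OF nonempty_edges, where X = X and M' = "\<lambda>_. borel"] measurable_X
    by simp
  also have "\<dots> = PiM E (\<lambda>_. weight_law)"
    by (rule PiM_cong) (simp_all add: distr_X)
  finally show ?thesis .
qed

text \<open>The joint law is a product of copies of one measure, which reindexing by a permutation
  preserves.\<close>

lemma prob_permute:
  assumes p: "p permutes E" and A: "A \<in> sets (PiM E (\<lambda>_. borel))"
  shows "prob {\<omega> \<in> space M. (\<lambda>x\<in>E. X (p x) \<omega>) \<in> A} = prob {\<omega> \<in> space M. (\<lambda>x\<in>E. X x \<omega>) \<in> A}"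
proof -
  let ?B = "PiM E (\<lambda>_. borel) :: ('e \<Rightarrow> real) measure" and ?N = "PiM E (\<lambda>_. weight_law)"
  let ?h = "\<lambda>w. \<lambda>x\<in>E. w (p x)"
  have pE: "p x \<in> E" if "x \<in> E" for x using permutes_in_image[OF p] that by simp
  have sN: "sets ?N = sets ?B" by (rule sets_PiM_cong) simp_all
  have XM: "(\<lambda>\<omega>. \<lambda>x\<in>E. X x \<omega>) \<in> measurable M ?B" by measurable
  have h: "?h \<in> measurable ?B ?B"
    by (rule measurable_restrict) (auto intro: measurable_component_singleton pE)
  have hA: "?h -` A \<inter> space ?B \<in> sets ?B" using measurable_sets[OF h A] .
  have "distr ?N ?N ?h = ?N"
    by (rule distr_PiM_reindex)
      (use prob_space_weight_law permutes_inj_on[OF p] pE in auto)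
  hence "measure ?N A = measure (distr ?N ?N ?h) A" by simp
  also have "\<dots> = measure ?N (?h -` A \<inter> space ?N)"
  proof (rule measure_distr)
    show "?h \<in> measurable ?N ?N" using h measurable_cong_sets[OF sN sN] by simp
  qed (use A sN in simp)
  finally have eq: "measure ?N A = measure ?N (?h -` A \<inter> space ?B)"
    using sets_eq_imp_space_eq[OF sN] by simp
  have "prob {\<omega> \<in> space M. (\<lambda>x\<in>E. X x \<omega>) \<in> C} = measure ?N C" if "C \<in> sets ?B" for C
    unfolding distr_weights[symmetric] measure_distr[OF XM that]
    by (rule arg_cong[where f = prob]) auto
  note this[OF A] this[OF hA]
  moreover have "{\<omega> \<in> space M. (\<lambda>x\<in>E. X x \<omega>) \<in> ?h -` A \<inter> space ?B} =
      {\<omega> \<in> space M. (\<lambda>x\<in>E. X (p x) \<omega>) \<in> A}"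
  proof -
    have "?h (\<lambda>x\<in>E. X x \<omega>) = (\<lambda>x\<in>E. X (p x) \<omega>)" for \<omega>
      using pE by (auto simp: fun_eq_iff)
    thus ?thesis by (auto simp: space_PiM)
  qed
  ultimately show ?thesis using eq by simp
qed

text \<open>By independence the pair has law \<open>weight_law\<close> times itself; the diagonal is
  null by Fubini, since each of its slices is a single point.\<close>

lemma AE_weights_neq:
  assumes "x \<in> E" "y \<in> E" "x \<noteq> y"
  shows "AE \<omega> in M. X x \<omega> \<noteq> X y \<omega>"
proof -
  have "indep_var (PiM {x} (\<lambda>_. borel)) (\<lambda>\<omega>. restrict (\<lambda>i. X i \<omega>) {x})
      (PiM {y} (\<lambda>_. borel)) (\<lambda>\<omega>. restrict (\<lambda>i. X i \<omega>) {y})"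
    by (rule indep_var_restrict[OF indep_X]) (use assms in auto)
  from indep_var_compose[OF this, of "\<lambda>w. w x" borel "\<lambda>w. w y" borel]
  have "indep_var borel (X x) borel (X y)" by (simp add: comp_def)
  hence d: "distr M (borel \<Otimes>\<^sub>M borel) (\<lambda>\<omega>. (X x \<omega>, X y \<omega>)) = weight_law \<Otimes>\<^sub>M weight_law"
    using assms by (simp add: indep_var_distribution_eq distr_X)
  interpret W: prob_space weight_law by (rule prob_space_weight_law)
  interpret WW: pair_prob_space weight_law weight_law ..
  have "AE y in weight_law. x \<noteq> y" for x
    by (rule AE_I[where N = "{x}"]) (auto simp: emeasure_weight_law_singleton)
  hence "AE z in weight_law \<Otimes>\<^sub>M weight_law. fst z \<noteq> snd z"
  proof (subst WW.AE_pair_iff[symmetric])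
    have "{z \<in> space (borel \<Otimes>\<^sub>M borel). fst z \<noteq> (snd z :: real)} \<in> sets (borel \<Otimes>\<^sub>M borel)"
      by measurable
    thus "{z \<in> space (weight_law \<Otimes>\<^sub>M weight_law). fst z \<noteq> snd z} \<in> sets (weight_law \<Otimes>\<^sub>M weight_law)"
      by (simp add: space_pair_measure weight_law_def cong: sets_pair_measure_cong)
  qed simp
  hence "AE z in distr M (borel \<Otimes>\<^sub>M borel) (\<lambda>\<omega>. (X x \<omega>, X y \<omega>)). fst z \<noteq> snd z"
    unfolding d .
  thus ?thesis using assms by (subst (asm) AE_distr_iff) auto
qed

lemma AE_inj_on_weights: "AE \<omega> in M. inj_on (\<lambda>x. X x \<omega>) E"
proof -
  have "AE \<omega> in M. \<forall>x\<in>E. \<forall>y\<in>E. x \<noteq> y \<longrightarrow> X x \<omega> \<noteq> X y \<omega>"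
    using AE_weights_neq by (intro AE_finite_allI finite_edges) auto
  thus ?thesis by eventually_elim (auto simp: inj_on_def)
qed

section \<open>Probabilities of being lightest\<close>

definition lightest :: "'e set \<Rightarrow> 'e \<Rightarrow> 'w \<Rightarrow> bool" where
  "lightest S x \<omega> \<longleftrightarrow> (\<forall>y\<in>S - {x}. X x \<omega> < X y \<omega>)"

lemma measurable_lightest [measurable]:
  assumes "S \<subseteq> E" "x \<in> E"
  shows "Measurable.pred M (lightest S x)"
proof -
  have "finite (S - {x})" using assms finite_edges by (auto intro: finite_subset)
  thus ?thesis unfolding lightest_def using assms
    by (intro pred_intros_finite borel_measurable_pred_less measurable_X) auto
qed

lemma prob_lightest_permute:
  assumes "p permutes E" "S \<subseteq> E" "U \<subseteq> E" "x \<in> E" "y \<in> E"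
  shows "prob {\<omega> \<in> space M. lightest S x \<omega> \<and> lightest U y \<omega>} =
    prob {\<omega> \<in> space M. lightest (p ` S) (p x) \<omega> \<and> lightest (p ` U) (p y) \<omega>}"
proof -
  define A where "A = {w \<in> space (PiM E (\<lambda>_. borel :: real measure)).
    (\<forall>z\<in>S - {x}. w x < w z) \<and> (\<forall>z\<in>U - {y}. w y < w z)}"
  have fin: "finite (S - {x})" "finite (U - {y})"
    using assms finite_edges by (auto intro: finite_subset)
  have "A \<in> sets (PiM E (\<lambda>_. borel))"
    unfolding A_def using fin assms
    by (intro sets.sets_Collect_conj sets.sets_Collect_finite_All borel_measurable_less
        measurable_component_singleton) auto
  from prob_permute[OF assms(1) this]
  have "prob {\<omega> \<in> space M. (\<lambda>x\<in>E. X (p x) \<omega>) \<in> A} = prob {\<omega> \<in> space M. (\<lambda>x\<in>E. X x \<omega>) \<in> A}" .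
  moreover have "(\<lambda>x\<in>E. X x \<omega>) \<in> A \<longleftrightarrow> lightest S x \<omega> \<and> lightest U y \<omega>" for \<omega>
    using assms by (auto simp: A_def lightest_def space_PiM subset_iff)
  moreover have "(\<lambda>x\<in>E. X (p x) \<omega>) \<in> A \<longleftrightarrow>
      lightest (p ` S) (p x) \<omega> \<and> lightest (p ` U) (p y) \<omega>" for \<omega>
  proof -
    have "p ` S - {p x} = p ` (S - {x})" "p ` U - {p y} = p ` (U - {y})"
      using permutes_inj[OF assms(1)] by (auto simp: inj_eq)
    thus ?thesis
      using assms(2-) by (auto simp: A_def lightest_def space_PiM subset_iff)
  qed
  ultimately show ?thesis by simp
qed

text \<open>Almost surely exactly one element of \<open>S\<close> is lightest, so these events split
  \<open>Q\<close> up to a null set. The extra event \<open>Q\<close> leaves room for a condition on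
  another edge.\<close>

lemma sum_prob_lightest:
  assumes "S \<subseteq> E" "S \<noteq> {}" and Q [measurable]: "Measurable.pred M Q"
  shows "(\<Sum>x\<in>S. prob {\<omega> \<in> space M. lightest S x \<omega> \<and> Q \<omega>}) = prob {\<omega> \<in> space M. Q \<omega>}"
proof -
  have fS: "finite S" using assms finite_edges finite_subset by blast
  let ?A = "\<lambda>x. {\<omega> \<in> space M. lightest S x \<omega> \<and> Q \<omega>}"
  have meas: "?A x \<in> events" if "x \<in> S" for x
  proof -
    have [measurable]: "Measurable.pred M (lightest S x)"
      using assms that by (intro measurable_lightest) auto
    show ?thesis by measurable
  qed
  have disj: "disjoint_family_on ?A S"
  proof (unfold disjoint_family_on_def, intro ballI impI)
    fix x y assume "x \<in> S" "y \<in> S" "x \<noteq> y"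
    hence "\<not> (lightest S x \<omega> \<and> lightest S y \<omega>)" for \<omega>
      by (metis DiffI lightest_def order_less_asym singletonD)
    thus "?A x \<inter> ?A y = {}" by blast
  qed
  have "(\<Sum>x\<in>S. prob (?A x)) = prob (\<Union>x\<in>S. ?A x)"
    by (rule finite_measure_finite_Union[symmetric]) (use fS meas disj in auto)
  also have "\<dots> = prob {\<omega> \<in> space M. Q \<omega>}"
  proof (rule finite_measure_eq_AE)
    show "AE \<omega> in M. (\<omega> \<in> (\<Union>x\<in>S. ?A x)) = (\<omega> \<in> {\<omega> \<in> space M. Q \<omega>})"
      using AE_inj_on_weights
    proof eventually_elim
      fix \<omega> assume inj: "inj_on (\<lambda>x. X x \<omega>) E"
      obtain x where "is_arg_min (\<lambda>x. X x \<omega>) (\<lambda>x. x \<in> S) x"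
        using ex_is_arg_min_if_finite[OF fS assms(2)] by blast
      hence x: "x \<in> S" "\<And>y. y \<in> S \<Longrightarrow> X x \<omega> \<le> X y \<omega>" by (auto simp: is_arg_min_linorder)
      have "X x \<omega> < X y \<omega>" if "y \<in> S - {x}" for y
        using x that inj_onD[OF inj, of x y] assms(1) by (force simp: order.strict_iff_order)
      hence "lightest S x \<omega>" by (simp add: lightest_def)
      thus "(\<omega> \<in> (\<Union>x\<in>S. ?A x)) = (\<omega> \<in> {\<omega> \<in> space M. Q \<omega>})" using x(1) by auto
    qed
  qed (use fS meas in auto)
  finally show ?thesis .
qed

lemma prob_lightest:
  assumes "S \<subseteq> E" "x \<in> S"
  shows "prob {\<omega> \<in> space M. lightest S x \<omega>} = 1 / real (card S)"
proof -
  have "finite S" using assms finite_edges finite_subset by blast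
  hence cS: "card S > 0" using assms by (auto simp: card_gt_0_iff)
  have eq: "prob {\<omega> \<in> space M. lightest S y \<omega>} = prob {\<omega> \<in> space M. lightest S x \<omega>}"
    if "y \<in> S" for y
    using prob_lightest_permute[OF permutes_swap_id[of y E x], of S S y y] assms that
    by (auto simp: subset_iff image_image)
  have "1 = (\<Sum>y\<in>S. prob {\<omega> \<in> space M. lightest S y \<omega>})"
    using sum_prob_lightest[of S "\<lambda>_. True"] assms prob_space by auto
  also have "\<dots> = card S * prob {\<omega> \<in> space M. lightest S x \<omega>}"
    using eq by simp
  finally show ?thesis using cS by (simp add: field_simps)
qed

text \<open>Conditionally on \<open>y\<close> being lightest in \<open>U\<close>, the weights on \<open>U - {y}\<close> remain exchangeable.\<close>

lemma prob_lightest_nested: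
  assumes "S \<subseteq> U - {y}" "U \<subseteq> E" "x \<in> S" "y \<in> U"
  shows "prob {\<omega> \<in> space M. lightest S x \<omega> \<and> lightest U y \<omega>} = 1 / (real (card S) * real (card U))"
proof -
  have SE: "S \<subseteq> E" using assms by auto
  hence "finite S" using finite_edges finite_subset by blast
  hence cS: "card S > 0" using assms by (auto simp: card_gt_0_iff)
  have eq: "prob {\<omega> \<in> space M. lightest S z \<omega> \<and> lightest U y \<omega>} =
      prob {\<omega> \<in> space M. lightest S x \<omega> \<and> lightest U y \<omega>}" if z: "z \<in> S" for z
  proof -
    \<comment> \<open>As \<open>y\<close> lies outside \<open>S\<close>, swapping \<open>z\<close>
      and \<open>x\<close> preserves both sets and fixes \<open>y\<close>; so all \<open>z\<close>
      contribute equally.\<close>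
    have "Transposition.transpose z x ` S = S" "Transposition.transpose z x ` U = U"
      "Transposition.transpose z x y = y"
      using assms z permutes_image[OF permutes_swap_id]
      by (auto simp: subset_iff intro!: transpose_apply_other)
    thus ?thesis
      using prob_lightest_permute[OF permutes_swap_id[of z E x], of S U z y] assms z SE
      by (auto simp: subset_iff)
  qed
  have "1 / real (card U) = (\<Sum>z\<in>S. prob {\<omega> \<in> space M. lightest S z \<omega> \<and> lightest U y \<omega>})"
    using sum_prob_lightest[of S "lightest U y"] prob_lightest[of U y] assms SE
      measurable_lightest[of U y] by (metis empty_iff subsetD)
  also have "\<dots> = card S * prob {\<omega> \<in> space M. lightest S x \<omega> \<and> lightest U y \<omega>}"
    using eq by simp
  finally have "prob {\<omega> \<in> space M. lightest S x \<omega> \<and> lightest U y \<omega>} =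
      1 / real (card U) / real (card S)"
    using cS by (subst nonzero_eq_divide_eq) (simp_all add: mult.commute)
  thus ?thesis by (simp add: mult.commute)
qed

text \<open>With ties \<^const>\<open>mst\<close> is unspecified, but it is still a function of the set of all minimum
  spanning trees, which ranges over a finite set.\<close>

lemma sets_mem_mst:
  "{\<omega> \<in> space M. e \<in> mst V E ends (\<lambda>x. X x \<omega>)} \<in> events"
proof -
  define ST where "ST = {T. mg_spanning_tree V E ends T}"
  have STE: "T \<subseteq> E" if "T \<in> ST" for T using that by (auto simp: ST_def mg_spanning_tree_def)
  hence "ST \<subseteq> Pow E" by auto
  hence fin: "finite ST" using finite_edges by (simp add: finite_subset)
  have ms: "(\<lambda>\<omega>. \<Sum>x\<in>T. X x \<omega>) \<in> borel_measurable M" if "T \<in> ST" for T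
    using STE[OF that] by (intro borel_measurable_sum measurable_X) auto
  let ?m = "\<lambda>\<omega>. {T. is_mst V E ends (\<lambda>x. X x \<omega>) T}"
  have m_eq: "?m \<omega> = {T \<in> ST. \<forall>T'\<in>ST. (\<Sum>x\<in>T. X x \<omega>) \<le> (\<Sum>x\<in>T'. X x \<omega>)}" for \<omega>
    by (auto simp: is_mst_def ST_def)
  have "{\<omega> \<in> space M. ?m \<omega> = \<T>} \<in> events" if "\<T> \<subseteq> ST" for \<T>
  proof -
    have "{\<omega> \<in> space M. ?m \<omega> = \<T>} =
      {\<omega> \<in> space M. \<forall>T\<in>ST. (\<forall>T'\<in>ST. (\<Sum>x\<in>T. X x \<omega>) \<le> (\<Sum>x\<in>T'. X x \<omega>)) = (T \<in> \<T>)}"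
      using that unfolding m_eq by blast
    also have "\<dots> \<in> events"
      using fin ms by (intro sets.sets_Collect_finite_All sets.sets_Collect borel_measurable_le) auto
    finally show ?thesis .
  qed
  hence "(\<Union>\<T>\<in>{\<T>\<in>Pow ST. e \<in> (THE T. T \<in> \<T>)}. {\<omega> \<in> space M. ?m \<omega> = \<T>}) \<in> events"
    using fin by (intro sets.finite_UN) auto
  also have "(\<Union>\<T>\<in>{\<T>\<in>Pow ST. e \<in> (THE T. T \<in> \<T>)}. {\<omega> \<in> space M. ?m \<omega> = \<T>}) =
      {\<omega> \<in> space M. e \<in> mst V E ends (\<lambda>x. X x \<omega>)}"
  proof -
    have "?m \<omega> \<subseteq> ST" for \<omega> by (auto simp: m_eq)
    thus ?thesis by (auto simp: mst_def)
  qed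
  finally show ?thesis .
qed

end

section \<open>Parallel classes of \<open>K\<^sub>4\<close>\<close>

text \<open>Inclusion-exclusion by linearity of expectation: an almost sure identity between
  indicators is integrated term by term.\<close>

lemma (in iid_weights) prob_eq_sum_list:
  assumes "{\<omega> \<in> space M. Q \<omega>} \<in> events"
    and "\<And>c B. (c, B) \<in> set cs \<Longrightarrow> {\<omega> \<in> space M. B \<omega>} \<in> events"
    and "AE \<omega> in M. of_bool (Q \<omega>) = (\<Sum>(c, B)\<leftarrow>cs. c * of_bool (B \<omega>) :: real)"
  shows "prob {\<omega> \<in> space M. Q \<omega>} = (\<Sum>(c, B)\<leftarrow>cs. c * prob {\<omega> \<in> space M. B \<omega>})"
proof -
  have ob: "has_bochner_integral M (\<lambda>\<omega>. of_bool (B \<omega>)) (prob {\<omega> \<in> space M. B \<omega>})"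
    if "{\<omega> \<in> space M. B \<omega>} \<in> events" for B
  proof -
    have "has_bochner_integral M (indicat_real {\<omega> \<in> space M. B \<omega>}) (prob {\<omega> \<in> space M. B \<omega>})"
      using has_bochner_integral_real_indicator[OF that] by (simp add: emeasure_eq_measure)
    thus ?thesis
      by (rule has_bochner_integral_cong[THEN iffD1, rotated -1]) (auto simp: indicator_def)
  qed
  have S: "has_bochner_integral M (\<lambda>\<omega>. \<Sum>(c, B)\<leftarrow>cs. c * of_bool (B \<omega>))
      (\<Sum>(c, B)\<leftarrow>cs. c * prob {\<omega> \<in> space M. B \<omega>})"
    using assms(2)
  proof (induction cs)
    case (Cons a cs)
    obtain c B where a: "a = (c, B)" by fastforce
    have "{\<omega> \<in> space M. B \<omega>} \<in> events" using Cons.prems a by auto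
    from has_bochner_integral_add[OF has_bochner_integral_mult_right[OF ob[OF this], of c] Cons.IH]
    show ?case using Cons.prems a by auto
  qed (simp add: has_bochner_integral_zero)
  from has_bochner_integral_cong_AE[OF borel_measurable_has_bochner_integral[OF ob[OF assms(1)]]
      borel_measurable_has_bochner_integral[OF S] assms(3)] S
  have "has_bochner_integral M (\<lambda>\<omega>. of_bool (Q \<omega>)) (\<Sum>(c, B)\<leftarrow>cs. c * prob {\<omega> \<in> space M. B \<omega>})"
    by simp
  with ob[OF assms(1)] show ?thesis by (rule has_bochner_integral_eq)
qed

definition copies :: "nat \<Rightarrow> nat \<Rightarrow> vertex set set \<Rightarrow> (vertex set \<times> nat) set" where
  "copies r s C = {x \<in> edges_G r s. fst x \<in> C}"

lemma UNIV_vertex: "UNIV = {Va, Vb, Vc, Vd}"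
  using vertex.exhaust by auto

instance vertex :: finite
  by standard (simp add: UNIV_vertex)

lemma copies_eq_Sigma: "C \<subseteq> K4_edges \<Longrightarrow> copies r s C = Sigma C (\<lambda>p. {..<multiplicity_G r s p})"
  by (auto simp: copies_def edges_G_def)

lemma card_copies: "C \<subseteq> K4_edges \<Longrightarrow> card (copies r s C) = (\<Sum>p\<in>C. multiplicity_G r s p)"
  by (simp add: copies_eq_Sigma)

lemma finite_edges_G: "finite (edges_G r s)"
proof -
  have "edges_G r s = copies r s K4_edges" by (auto simp: copies_def edges_G_def)
  thus ?thesis by (simp add: copies_eq_Sigma)
qed

lemma multigraph_edges_G:
  assumes "r \<ge> 1" "s \<ge> 1"
  shows "multigraph UNIV (edges_G r s) fst"
proof
  show "finite (edges_G r s)" by (rule finite_edges_G)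
  show "fst x \<subseteq> UNIV \<and> card (fst x) = 2" if "x \<in> edges_G r s" for x
    using that by (auto simp: edges_G_def K4_edges_def)
  have "mg_reach fst (edges_G r s) u v" for u v
  proof (cases "u = v")
    case False
    hence "({u, v}, 0) \<in> edges_G r s"
      using assms by (auto simp: edges_G_def K4_edges_def multiplicity_G_def)
    thus ?thesis by (rule mg_reach_edge) simp
  qed simp
  thus "mg_connected UNIV fst (edges_G r s)" by (simp add: mg_connected_def)
qed

text \<open>The atoms of the Boolean description: being lightest in a union of classes is a
  conjunction of these.\<close>

definition lighter :: "nat \<Rightarrow> nat \<Rightarrow> (vertex set \<times> nat \<Rightarrow> real) \<Rightarrow> vertex set \<times> nat \<Rightarrow> vertex set \<Rightarrow> bool" where
  "lighter r s w e p \<longleftrightarrow> (\<forall>x\<in>copies r s {p} - {e}. w e < w x)"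

text \<open>Up to complement, the sets separating \<open>a\<close> from \<open>b\<close> are
  \<open>{a}\<close>, \<open>{b}\<close>, \<open>{a, c}\<close> and \<open>{a, d}\<close>. The first
  two give stars, which miss the class \<open>{c, d}\<close>; the other two cuts contain it.\<close>

lemma mem_mst_G_iff:
  assumes rs: "r \<ge> 1" "s \<ge> 1" and inj: "inj_on w (edges_G r s)"
    and e: "e \<in> edges_G r s" "fst e = {a, b}"
    and abcd: "distinct [a, b, c, d]" "UNIV = {a, b, c, d}"
  shows "e \<in> mst_G r s w \<longleftrightarrow> lighter r s w e {a, b} \<and>
    (lighter r s w e {a, c} \<and> lighter r s w e {a, d} \<or>
     lighter r s w e {b, c} \<and> lighter r s w e {b, d} \<or>
     lighter r s w e {c, d} \<and>
       (lighter r s w e {a, d} \<and> lighter r s w e {b, c} \<or>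
        lighter r s w e {a, c} \<and> lighter r s w e {b, d}))"
proof -
  interpret multigraph UNIV "edges_G r s" fst by (rule multigraph_edges_G[OF rs])
  let ?L = "lighter r s w e"
  have "e \<in> mst_G r s w \<longleftrightarrow> (\<exists>U. e \<in> cut U \<and> (\<forall>g\<in>cut U - {e}. w e < w g))"
    by (rule mem_mst_iff_lightest_in_cut[OF inj])
  also have "\<dots> \<longleftrightarrow> (\<exists>U. (a \<in> U) \<noteq> (b \<in> U) \<and> (\<forall>u v. u \<in> U \<longrightarrow> v \<notin> U \<longrightarrow> ?L {u, v}))"
  proof (intro arg_cong[where f = Ex] ext arg_cong2[where f = "(\<and>)"])
    fix U
    show "(e \<in> cut U) = ((a \<in> U) \<noteq> (b \<in> U))"
      using e by (auto simp: cut_def doubleton_eq_iff)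
    show "(\<forall>g\<in>cut U - {e}. w e < w g) = (\<forall>u v. u \<in> U \<longrightarrow> v \<notin> U \<longrightarrow> ?L {u, v})"
      by (auto simp: cut_def lighter_def copies_def)
  qed
  also have "\<dots> \<longleftrightarrow> ?L {a, b} \<and> (?L {a, c} \<and> ?L {a, d} \<or> ?L {b, c} \<and> ?L {b, d} \<or>
      ?L {c, d} \<and> (?L {a, d} \<and> ?L {b, c} \<or> ?L {a, c} \<and> ?L {b, d}))" (is "?lhs \<longleftrightarrow> ?rhs")
  proof
    assume ?lhs
    then obtain U where U: "(a \<in> U) \<noteq> (b \<in> U)" "\<And>u v. u \<in> U \<Longrightarrow> v \<notin> U \<Longrightarrow> ?L {u, v}"
      by blast
    have "?L {u, v}" if "(u \<in> U) \<noteq> (v \<in> U)" for u v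
      using U(2)[of u v] U(2)[of v u] that by (auto simp: insert_commute)
    from this[of a b] this[of a c] this[of a d] this[of b c] this[of b d] this[of c d] U(1)
    show ?rhs by argo
  next
    assume ?rhs
    have V: "v = a \<or> v = b \<or> v = c \<or> v = d" for v using abcd(2) by blast
    from \<open>?rhs\<close> consider "?L {a, b}" "?L {a, c}" "?L {a, d}" | "?L {a, b}" "?L {b, c}" "?L {b, d}"
      | "?L {a, b}" "?L {c, d}" "?L {a, d}" "?L {b, c}"
      | "?L {a, b}" "?L {c, d}" "?L {a, c}" "?L {b, d}" by argo
    thus ?lhs
    proof cases
      case 1
      show ?thesis
      proof (intro exI conjI allI impI)
        show "(a \<in> {a}) \<noteq> (b \<in> {a})" using abcd(1) by auto
        fix u v assume "u \<in> {a}" "v \<notin> {a}"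
        hence "u = a" "v = b \<or> v = c \<or> v = d" using V[of v] by auto
        thus "?L {u, v}" using 1 by (elim disjE) (simp_all add: insert_commute)
      qed
    next
      case 2
      show ?thesis
      proof (intro exI conjI allI impI)
        show "(a \<in> {b}) \<noteq> (b \<in> {b})" using abcd(1) by auto
        fix u v assume "u \<in> {b}" "v \<notin> {b}"
        hence "u = b" "v = a \<or> v = c \<or> v = d" using V[of v] by auto
        thus "?L {u, v}" using 2 by (elim disjE) (simp_all add: insert_commute)
      qed
    next
      case 3
      show ?thesis
      proof (intro exI conjI allI impI)
        show "(a \<in> {a, c}) \<noteq> (b \<in> {a, c})" using abcd(1) by auto
        fix u v assume "u \<in> {a, c}" "v \<notin> {a, c}"
        hence "u = a \<or> u = c" "v = b \<or> v = d" using V[of v] by auto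
        thus "?L {u, v}" using 3 by (elim disjE) (simp_all add: insert_commute)
      qed
    next
      case 4
      show ?thesis
      proof (intro exI conjI allI impI)
        show "(a \<in> {a, d}) \<noteq> (b \<in> {a, d})" using abcd(1) by auto
        fix u v assume "u \<in> {a, d}" "v \<notin> {a, d}"
        hence "u = a \<or> u = d" "v = b \<or> v = c" using V[of v] by auto
        thus "?L {u, v}" using 4 by (elim disjE) (simp_all add: insert_commute)
      qed
    qed
  qed
  finally show ?thesis .
qed

text \<open>Inclusion-exclusion over the four cuts. The union of all six classes arises from one
  pair, all four triples and the quadruple, whence the coefficient -1 + 4 - 1 = 2.\<close>

lemma of_bool_mem_tree:
  "(of_bool (P \<and> (p \<and> q \<or> x \<and> y \<or> c \<and> (q \<and> x \<or> p \<and> y))) :: real) =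
    of_bool (P \<and> p \<and> q) + of_bool (P \<and> x \<and> y) - of_bool (P \<and> p \<and> q \<and> x \<and> y)
    + of_bool (P \<and> c \<and> q \<and> x) + of_bool (P \<and> c \<and> p \<and> y)
    - of_bool (P \<and> c \<and> p \<and> q \<and> x) - of_bool (P \<and> c \<and> p \<and> q \<and> y)
    - of_bool (P \<and> c \<and> p \<and> x \<and> y) - of_bool (P \<and> c \<and> q \<and> x \<and> y)
    + 2 * of_bool (P \<and> c \<and> p \<and> q \<and> x \<and> y)"
  by (cases P; cases p; cases q; cases x; cases y; cases c) simp_all

text \<open>Here \<open>L\<close> stands for comparisons with \<open>e\<close>, \<open>H\<close> for comparisons with \<open>f\<close>, and \<open>lt\<close> says that
  \<open>f\<close> is lighter than \<open>e\<close>; then only the cuts around the ends of \<open>e\<close> can put \<open>e\<close> into the tree.\<close>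

lemma of_bool_mem_tree_both:
  assumes "lt \<Longrightarrow> Lab \<Longrightarrow> Hab" "lt \<Longrightarrow> Lac \<Longrightarrow> Hac" "lt \<Longrightarrow> Lad \<Longrightarrow> Had"
    "lt \<Longrightarrow> Lbc \<Longrightarrow> Hbc" "lt \<Longrightarrow> Lbd \<Longrightarrow> Hbd" "lt \<Longrightarrow> \<not> Lcd" "Hab \<Longrightarrow> lt"
  shows "(of_bool ((Lab \<and> (Lac \<and> Lad \<or> Lbc \<and> Lbd \<or> Lcd \<and> (Lad \<and> Lbc \<or> Lac \<and> Lbd))) \<and>
      (Hcd \<and> (Hac \<and> Hbc \<or> Had \<and> Hbd \<or> Hab \<and> (Hbc \<and> Had \<or> Hac \<and> Hbd))) \<and> lt) :: real) =
    of_bool ((Lab \<and> Lac \<and> Lad) \<and> (Hab \<and> Hac \<and> Had \<and> Hcd \<and> Hbc))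
    + of_bool ((Lab \<and> Lac \<and> Lad) \<and> (Hab \<and> Hac \<and> Had \<and> Hcd \<and> Hbd))
    - of_bool ((Lab \<and> Lac \<and> Lad) \<and> (Hab \<and> Hac \<and> Had \<and> Hcd \<and> Hbc \<and> Hbd))
    + of_bool ((Lab \<and> Lbc \<and> Lbd) \<and> (Hab \<and> Hbc \<and> Hbd \<and> Hcd \<and> Hac))
    + of_bool ((Lab \<and> Lbc \<and> Lbd) \<and> (Hab \<and> Hbc \<and> Hbd \<and> Hcd \<and> Had))
    - of_bool ((Lab \<and> Lbc \<and> Lbd) \<and> (Hab \<and> Hac \<and> Had \<and> Hcd \<and> Hbc \<and> Hbd))
    - of_bool ((Lab \<and> Lac \<and> Lad \<and> Lbc \<and> Lbd) \<and> (Hab \<and> Hac \<and> Had \<and> Hcd \<and> Hbc \<and> Hbd))"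
proof (cases "lt \<and> Lab \<and> Hcd")
  case True
  with assms have "\<not> Lcd" "Hab" by auto
  with True assms(2-5) show ?thesis
    by (cases Lac; cases Lad; cases Lbc; cases Lbd; cases Hac; cases Had; cases Hbc; cases Hbd) simp_all
next
  case False
  \<comment> \<open>Every term on the right contains \<open>Lab\<close>, \<open>Hab\<close> and
    \<open>Hcd\<close>, so both sides vanish.\<close>
  hence "\<not> (Lab \<and> Hab \<and> Hcd)" using assms(7) by blast
  with False show ?thesis by (cases Lab; cases Hab; cases Hcd) simp_all
qed

section \<open>Tree probabilities in the multiplied \<open>K4\<close>\<close>

locale K4_weights = iid_weights M "edges_G r s" X
  for M :: "'w measure" and r s :: nat and X +
  assumes r_pos: "r \<ge> 1" and s_pos: "s \<ge> 1"
begin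

lemma copies_subset: "copies r s C \<subseteq> edges_G r s"
  by (auto simp: copies_def)

lemma lightest_copies_iff:
  "lightest (copies r s C) e \<omega> \<longleftrightarrow> (\<forall>p\<in>C. lighter r s (\<lambda>x. X x \<omega>) e p)"
  by (auto simp: lightest_def lighter_def copies_def)

text \<open>The labels stay abstract, with only the unordered pair of multiplied classes fixed, so
  that one computation serves both edges and both orders of their weights.\<close>

context
  fixes a b c d :: vertex and e :: "vertex set \<times> nat"
  assumes abcd: "distinct [a, b, c, d]" and classes: "{{a, b}, {c, d}} = {{Va, Vb}, {Vc, Vd}}"
    and e: "e \<in> edges_G r s" "fst e = {a, b}"
begin

abbreviation "m \<equiv> multiplicity_G r s {a, b}"
abbreviation "k \<equiv> multiplicity_G r s {c, d}"

lemma UNIV_abcd: "UNIV = {a, b, c, d}"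
proof -
  have "{a, b} \<union> {c, d} = {Va, Vb} \<union> {Vc, Vd}"
    using classes by (metis Union_insert Union_empty Un_empty_right)
  thus ?thesis by (auto simp: UNIV_vertex)
qed

lemma multiplicity_single:
  assumes "p \<noteq> {a, b}" "p \<noteq> {c, d}"
  shows "multiplicity_G r s p = 1"
proof -
  have "p \<notin> {{Va, Vb}, {Vc, Vd}}" using assms unfolding classes[symmetric] by simp
  thus ?thesis by (simp add: multiplicity_G_def)
qed

lemma pair_neq:
  "a \<noteq> b" "a \<noteq> c" "a \<noteq> d" "b \<noteq> c" "b \<noteq> d" "c \<noteq> d"
  using abcd by auto

lemma pairs_K4:
  "{a, b} \<in> K4_edges" "{a, c} \<in> K4_edges" "{a, d} \<in> K4_edges"
  "{b, c} \<in> K4_edges" "{b, d} \<in> K4_edges" "{c, d} \<in> K4_edges"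
  using pair_neq by (auto simp: K4_edges_def)

lemmas cards = card_copies multiplicity_single doubleton_eq_iff pair_neq pair_neq[symmetric] pairs_K4

lemma prob_lightest_copies:
  assumes "{a, b} \<in> C"
  shows "prob {\<omega> \<in> space M. lightest (copies r s C) e \<omega>} = 1 / real (card (copies r s C))"
  by (rule prob_lightest[OF copies_subset]) (simp add: copies_def e assms)

lemma prob_mem_mst:
  "prob {\<omega> \<in> space M. e \<in> mst_G r s (\<lambda>x. X x \<omega>)} =
    2 / (real m + 2) - 1 / (real m + 4) + 2 / (real (m + k) + 2) - 4 / (real (m + k) + 3)
    + 2 / (real (m + k) + 4)"
proof -
  \<comment> \<open>The stars have \<open>m + 2\<close> edges, the two cuts through
    \<open>{c, d}\<close> have \<open>m + k + 2\<close>; their unions have \<open>m + 4\<close>,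
    \<open>m + k + 3\<close> or \<open>m + k + 4\<close>.\<close>
  let ?cs = "[(1, {{a,b}, {a,c}, {a,d}}), (1, {{a,b}, {b,c}, {b,d}}),
    (-1, {{a,b}, {a,c}, {a,d}, {b,c}, {b,d}}),
    (1, {{a,b}, {c,d}, {a,d}, {b,c}}), (1, {{a,b}, {c,d}, {a,c}, {b,d}}),
    (-1, {{a,b}, {c,d}, {a,c}, {a,d}, {b,c}}), (-1, {{a,b}, {c,d}, {a,c}, {a,d}, {b,d}}),
    (-1, {{a,b}, {c,d}, {a,c}, {b,c}, {b,d}}), (-1, {{a,b}, {c,d}, {a,d}, {b,c}, {b,d}}),
    (2 :: real, {{a,b}, {c,d}, {a,c}, {a,d}, {b,c}, {b,d}})]"
  have "prob {\<omega> \<in> space M. e \<in> mst_G r s (\<lambda>x. X x \<omega>)} =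
    (\<Sum>(q, B)\<leftarrow>map (\<lambda>(q, C). (q, lightest (copies r s C) e)) ?cs. q * prob {\<omega> \<in> space M. B \<omega>})"
  proof (rule prob_eq_sum_list[OF sets_mem_mst])
    show "{\<omega> \<in> space M. B \<omega>} \<in> events"
      if "(q, B) \<in> set (map (\<lambda>(q, C). (q, lightest (copies r s C) e)) ?cs)" for q B
      using that measurable_lightest[OF copies_subset e(1)] by (auto simp: pred_def)
    show "AE \<omega> in M. of_bool (e \<in> mst_G r s (\<lambda>x. X x \<omega>)) =
        (\<Sum>(q, B)\<leftarrow>map (\<lambda>(q, C). (q, lightest (copies r s C) e)) ?cs. q * of_bool (B \<omega>))"
      using AE_inj_on_weights
    proof eventually_elim
      fix \<omega> assume inj: "inj_on (\<lambda>x. X x \<omega>) (edges_G r s)"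
      show "of_bool (e \<in> mst_G r s (\<lambda>x. X x \<omega>)) =
        (\<Sum>(q, B)\<leftarrow>map (\<lambda>(q, C). (q, lightest (copies r s C) e)) ?cs. q * of_bool (B \<omega>))"
        unfolding mem_mst_G_iff[OF r_pos s_pos inj e abcd UNIV_abcd] of_bool_mem_tree
        by (simp add: lightest_copies_iff)
    qed
  qed
  thus ?thesis
    by (simp add: prob_lightest_copies cards) (simp add: add_ac)
qed

lemma prob_mem_mst_both_less:
  assumes f: "f \<in> edges_G r s" "fst f = {c, d}"
  shows "prob {\<omega> \<in> space M. e \<in> mst_G r s (\<lambda>x. X x \<omega>) \<and> f \<in> mst_G r s (\<lambda>x. X x \<omega>) \<and> X f \<omega> < X e \<omega>} =
    2 / (real m + 2) * (2 / (real (m + k) + 3) - 1 / (real (m + k) + 4))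
    - 1 / ((real m + 4) * (real (m + k) + 4))"
proof -
  let ?ab = "{a, b}" and ?ac = "{a, c}" and ?ad = "{a, d}" and ?bc = "{b, c}" and ?bd = "{b, d}"
    and ?cd = "{c, d}"
  let ?all = "{?ab, ?ac, ?ad, ?cd, ?bc, ?bd}"
  \<comment> \<open>Once \<open>f\<close> beats the star of \<open>a\<close>, any cut of
    \<open>f\<close> asks only for \<open>?cd\<close> and one of \<open>?bc\<close>,
    \<open>?bd\<close>: two sets of five classes minus the full set. The star of \<open>b\<close> is
    symmetric, and the last term removes the overlap of the two stars.\<close>
  let ?cs = "[(1, {?ab, ?ac, ?ad}, {?ab, ?ac, ?ad, ?cd, ?bc}),
    (1, {?ab, ?ac, ?ad}, {?ab, ?ac, ?ad, ?cd, ?bd}), (-1, {?ab, ?ac, ?ad}, ?all),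
    (1, {?ab, ?bc, ?bd}, {?ab, ?bc, ?bd, ?cd, ?ac}),
    (1, {?ab, ?bc, ?bd}, {?ab, ?bc, ?bd, ?cd, ?ad}), (-1, {?ab, ?bc, ?bd}, ?all),
    (-1 :: real, {?ab, ?ac, ?ad, ?bc, ?bd}, ?all)]"
  let ?B = "\<lambda>C D \<omega>. lightest (copies r s C) e \<omega> \<and> lightest (copies r s D) f \<omega>"
  let ?cs' = "map (\<lambda>(q, C, D). (q, ?B C D)) ?cs"
  let ?Q = "\<lambda>\<omega>. e \<in> mst_G r s (\<lambda>x. X x \<omega>) \<and> f \<in> mst_G r s (\<lambda>x. X x \<omega>) \<and> X f \<omega> < X e \<omega>"
  have P: "prob {\<omega> \<in> space M. ?B C D \<omega>} = 1 / (real (card (copies r s C)) * real (card (copies r s D)))"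
    if "?ab \<in> C" "C \<subseteq> D" "?cd \<in> D" "?cd \<notin> C" for C D
    by (rule prob_lightest_nested) (use that e f in \<open>auto simp: copies_def\<close>)
  have "prob {\<omega> \<in> space M. ?Q \<omega>} = (\<Sum>(q, B)\<leftarrow>?cs'. q * prob {\<omega> \<in> space M. B \<omega>})"
  proof (rule prob_eq_sum_list)
    show "{\<omega> \<in> space M. ?Q \<omega>} \<in> events"
      using e f by (intro sets.sets_Collect_conj sets_mem_mst borel_measurable_less measurable_X) auto
    have "{\<omega> \<in> space M. ?B C D \<omega>} \<in> events" for C D
      using measurable_lightest[OF copies_subset e(1)] measurable_lightest[OF copies_subset f(1)]
      by (intro sets.sets_Collect_conj) (auto simp: pred_def)
    thus "{\<omega> \<in> space M. B \<omega>} \<in> events" if "(q, B) \<in> set ?cs'" for q B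
      using that by auto
    show "AE \<omega> in M. of_bool (?Q \<omega>) = (\<Sum>(q, B)\<leftarrow>?cs'. q * of_bool (B \<omega>))"
      using AE_inj_on_weights
    proof eventually_elim
      fix \<omega> assume inj: "inj_on (\<lambda>x. X x \<omega>) (edges_G r s)"
      let ?L = "lighter r s (\<lambda>x. X x \<omega>) e" and ?G = "lighter r s (\<lambda>x. X x \<omega>) f"
      have abcd': "distinct [c, d, a, b]" "UNIV = {c, d, a, b}"
        using abcd UNIV_abcd by auto
      have fT: "f \<in> mst_G r s (\<lambda>x. X x \<omega>) \<longleftrightarrow>
        (?G ?cd \<and> (?G ?ac \<and> ?G ?bc \<or> ?G ?ad \<and> ?G ?bd \<or> ?G ?ab \<and> (?G ?bc \<and> ?G ?ad \<or> ?G ?ac \<and> ?G ?bd)))"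
        using mem_mst_G_iff[OF r_pos s_pos inj f abcd'] by (simp add: insert_commute)
      have LG: "?G p" if "X f \<omega> < X e \<omega>" "?L p" for p
        using that unfolding lighter_def by (metis DiffD1 DiffI order_less_trans singletonD)
      have ef: "e \<in> copies r s {?ab}" "f \<in> copies r s {?cd}" "e \<noteq> f"
        using e f cards by (auto simp: copies_def)
      have nL: "\<not> ?L ?cd" if "X f \<omega> < X e \<omega>"
        unfolding lighter_def using that ef by (metis DiffI order_less_asym singletonD)
      have lt: "X f \<omega> < X e \<omega>" if "?G ?ab"
        using that ef by (auto simp: lighter_def)
      show "of_bool (?Q \<omega>) = (\<Sum>(q, B)\<leftarrow>?cs'. q * of_bool (B \<omega>))"
        unfolding mem_mst_G_iff[OF r_pos s_pos inj e abcd UNIV_abcd] fT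
        by (rule trans[OF of_bool_mem_tree_both], (erule (1) LG)+, erule nL, erule lt)
          (simp add: lightest_copies_iff)
    qed
  qed
  also have "\<dots> = 2 / (real m + 2) * (2 / (real (m + k) + 3) - 1 / (real (m + k) + 4))
    - 1 / ((real m + 4) * (real (m + k) + 4))"
    by (simp add: P cards)
      (simp only: divide_inverse inverse_mult_distrib mult_1_left, simp only: algebra_simps)
  finally show ?thesis .
qed

end

end

section \<open>The correlation ratio as a rational function\<close>

text \<open>The formulas of \<open>prob_mem_mst\<close> and \<open>prob_mem_mst_both_less\<close> for an \<open>m\<close>-fold edge opposite
  to a \<open>k\<close>-fold one.\<close>

definition edge_prob :: "real \<Rightarrow> real \<Rightarrow> real" where
  "edge_prob m k = 2 / (m + 2) - 1 / (m + 4) + 2 / (m + k + 2) - 4 / (m + k + 3) + 2 / (m + k + 4)"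

definition both_prob_less :: "real \<Rightarrow> real \<Rightarrow> real" where
  "both_prob_less m k =
     2 / (m + 2) * (2 / (m + k + 3) - 1 / (m + k + 4)) - 1 / ((m + 4) * (m + k + 4))"

definition ratio :: "real \<Rightarrow> real \<Rightarrow> real" where
  "ratio m k = (both_prob_less m k + both_prob_less k m) / (edge_prob m k * edge_prob k m)"

definition edge_numer :: "real \<Rightarrow> real \<Rightarrow> real" where
  "edge_numer m k = (m + 6) * (m + k + 2) * (m + k + 3) * (m + k + 4) + 4 * (m + 2) * (m + 4)"

text \<open>The first product comes from the stars, using 2/y - 1/(y+1) = (y+2)/(y(y+1)) for y =
  m+k+3; the second collects the two overlap corrections.\<close>

definition both_numer :: "real \<Rightarrow> real \<Rightarrow> real" where
  "both_numer m k = (2 * (m + k) + 10) * (m + 4) * (k + 4) * (m + k + 4)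
     - (m + k + 8) * (m + 2) * (k + 2) * (m + k + 3)"

lemma edge_prob_eq:
  assumes "m > 0" "k > 0"
  shows "edge_prob m k = edge_numer m k / ((m + 2) * (m + 4) * (m + k + 2) * (m + k + 3) * (m + k + 4))"
proof -
  define x where "x = m + k + 2"
  have n: "m + k + 2 = x" "m + k + 3 = x + 1" "m + k + 4 = x + 2" by (simp_all add: x_def)
  have x: "x > 0" using assms by (simp add: x_def)
  have "edge_prob m k = (2 / (m + 2) - 1 / (m + 4)) + (2 / x - 4 / (x + 1) + 2 / (x + 2))"
    by (simp add: edge_prob_def n)
  also have "2 / (m + 2) - 1 / (m + 4) = (m + 6) / ((m + 2) * (m + 4))"
    using assms by (simp add: field_simps)
  \<comment> \<open>A second difference of \<open>2 / x\<close>.\<close>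
  also have "2 / x - 4 / (x + 1) + 2 / (x + 2) = 4 / (x * (x + 1) * (x + 2))"
    using x by (simp add: divide_simps) (simp add: algebra_simps)
  also have "(m + 6) / ((m + 2) * (m + 4)) + 4 / (x * (x + 1) * (x + 2)) =
      ((m + 6) * (x * (x + 1) * (x + 2)) + 4 * ((m + 2) * (m + 4))) /
      ((m + 2) * (m + 4) * (x * (x + 1) * (x + 2)))"
    using assms x by (subst add_frac_eq) auto
  also have "\<dots> = edge_numer m k / ((m + 2) * (m + 4) * (m + k + 2) * (m + k + 3) * (m + k + 4))"
    unfolding edge_numer_def n by (simp only: mult.assoc)
  finally show ?thesis .
qed

lemma both_prob_eq:
  assumes "m > 0" "k > 0"
  shows "both_prob_less m k + both_prob_less k m = both_numer m k /
    ((m + 2) * (k + 2) * (m + 4) * (k + 4) * (m + k + 3) * (m + k + 4))"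
  using assms
  by (simp add: both_prob_less_def both_numer_def add.commute[of k m] divide_simps) algebra

lemma edge_numer_pos: "m > 0 \<Longrightarrow> k > 0 \<Longrightarrow> edge_numer m k > 0"
  unfolding edge_numer_def by (intro add_pos_pos mult_pos_pos) auto

lemma ratio_eq:
  assumes "m > 0" "k > 0"
  shows "ratio m k = both_numer m k * ((m + k + 2)^2 * (m + k + 3) * (m + k + 4)) /
    (edge_numer m k * edge_numer k m)"
proof -
  have *: "N / (a * b * a' * b' * y * z) / (A / (a * a' * x * y * z) * (B / (b * b' * x * y * z))) =
      N * (x^2 * y * z) / (A * B)"
    if "a \<noteq> 0" "b \<noteq> 0" "a' \<noteq> 0" "b' \<noteq> 0" "x \<noteq> 0" "y \<noteq> 0" "z \<noteq> 0" "A \<noteq> 0" "B \<noteq> 0"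
    for N A B a b a' b' x y z :: real
    using that by (simp add: field_simps power2_eq_square)
  show ?thesis
    unfolding ratio_def both_prob_eq[OF assms] edge_prob_eq[OF assms] edge_prob_eq[OF assms(2,1)]
      add.commute[of k m]
    using assms edge_numer_pos[of m k] edge_numer_pos[of k m] by (intro *) auto
qed

lemma ratio_commute: "ratio m k = ratio k m"
  by (simp add: ratio_def add.commute mult.commute)

section \<open>The upper bound as a polynomial inequality\<close>

definition gap :: "real \<Rightarrow> real \<Rightarrow> real" where
  "gap m k = 78100 * (edge_numer m k * edge_numer k m) -
     77841 * (both_numer m k * ((m + k + 2)^2 * (m + k + 3) * (m + k + 4)))"

text \<open>The right-hand side is the linear part of \<open>gap\<close> at (4, 4), where
  \<open>gap\<close> vanishes because the bound is attained. By symmetry the coefficient of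
  \<open>i\<close>, which moves both arguments, is twice that of \<open>j\<close>. All higher
  coefficients are positive; the top-degree part of \<open>gap m k\<close> is 259 m k (m+k)^6, with
  259 = 78100 - 77841.\<close>

lemma gap_ge_4:
  assumes "i \<ge> 0" "j \<ge> 0"
  shows "gap (4 + i) (4 + i + j) \<ge> 1512224640 * i + 756112320 * j"
proof -
  have "gap (4 + i) (4 + i + j) - (1512224640 * i + 756112320 * j) =
    16576 * i ^ 8 + 66304 * i ^ 7 * j + 111888 * i ^ 6 * j ^ 2 + 103600 * i ^ 5 * j ^ 3
      + 56980 * i ^ 4 * j ^ 4 + 18648 * i ^ 3 * j ^ 5 + 3367 * i ^ 2 * j ^ 6 + 259 * i * j ^ 7
      + 878528 * i ^ 7 + 3074848 * i ^ 6 * j + 4475520 * i ^ 5 * j ^ 2 + 3501680 * i ^ 4 * j ^ 3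
      + 1579900 * i ^ 3 * j ^ 4 + 405594 * i ^ 2 * j ^ 5 + 53354 * i * j ^ 6 + 2590 * j ^ 7
      + 20127408 * i ^ 6 + 60382224 * i ^ 5 * j + 73595368 * i ^ 4 * j ^ 2
      + 46553696 * i ^ 3 * j ^ 3 + 16045827 * i ^ 2 * j ^ 4 + 2832683 * i * j ^ 5 + 196840 * j ^ 6
      + 235698752 * i ^ 5 + 589246880 * i ^ 4 * j + 576663808 * i ^ 3 * j ^ 2
      + 275748832 * i ^ 2 * j ^ 3 + 64218556 * i * j ^ 4 + 5792702 * j ^ 5 + 1478967856 * i ^ 4
      + 2957935712 * i ^ 3 * j + 2181223996 * i ^ 2 * j ^ 2 + 702256140 * i * j ^ 3
      + 83206644 * j ^ 4 + 4804744224 * i ^ 3 + 7207116336 * i ^ 2 * j + 3581580288 * i * j ^ 2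
      + 589604088 * j ^ 3 + 6721533504 * i ^ 2 + 6721533504 * i * j + 1739088176 * j ^ 2"
    unfolding gap_def edge_numer_def both_numer_def by algebra
  also have "\<dots> \<ge> 0"
    using assms by (intro add_nonneg_nonneg mult_nonneg_nonneg zero_le_power) auto
  finally show ?thesis by simp
qed

text \<open>Row \<open>m\<close> starts at 8 - m, where all coefficients in the shift are positive;
  the finitely many earlier entries are evaluated directly.\<close>

lemma gap_pos_small:
  assumes "j \<ge> 0"
  shows "gap 1 (7 + j) > 0" "gap 2 (6 + j) > 0" "gap 3 (5 + j) > 0"
proof -
  have "gap 1 (7 + j) =
    1813 * j ^ 7 + 143227 * j ^ 6 + 4227047 * j ^ 5 + 60096609 * j ^ 4 + 423171300 * j ^ 3
      + 1289040404 * j ^ 2 + 1132446480 * j + 2214590400"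
    unfolding gap_def edge_numer_def both_numer_def by algebra
  also have "\<dots> > 0"
    using assms by (intro add_nonneg_pos add_nonneg_nonneg mult_nonneg_nonneg zero_le_power) auto
  finally show "gap 1 (7 + j) > 0" .
  have "gap 2 (6 + j) =
    2072 * j ^ 7 + 161616 * j ^ 6 + 4783120 * j ^ 5 + 68741160 * j ^ 4 + 491231968 * j ^ 3
      + 1509763104 * j ^ 2 + 1069921280 * j + 959270400"
    unfolding gap_def edge_numer_def both_numer_def by algebra
  also have "\<dots> > 0"
    using assms by (intro add_nonneg_pos add_nonneg_nonneg mult_nonneg_nonneg zero_le_power) auto
  finally show "gap 2 (6 + j) > 0" .
  have "gap 3 (5 + j) =
    2331 * j ^ 7 + 179487 * j ^ 6 + 5305005 * j ^ 5 + 76444505 * j ^ 4 + 546709564 * j ^ 3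
      + 1659779028 * j ^ 2 + 949474960 * j + 236068800"
    unfolding gap_def edge_numer_def both_numer_def by algebra
  also have "\<dots> > 0"
    using assms by (intro add_nonneg_pos add_nonneg_nonneg mult_nonneg_nonneg zero_le_power) auto
  finally show "gap 3 (5 + j) > 0" .
qed

lemma gap_pos:
  fixes r s :: nat
  assumes "1 \<le> r" "r \<le> s" "\<not> (r = 4 \<and> s = 4)"
  shows "gap (real r) (real s) > 0"
proof (cases "r \<ge> 4")
  case True
  define i j where "i = real r - 4" and "j = real s - real r"
  have "i \<ge> 0" "j \<ge> 0" "i > 0 \<or> j > 0" using True assms by (auto simp: i_def j_def)
  with gap_ge_4[of i j] show ?thesis by (auto simp: i_def j_def)
next
  case False
  show ?thesis
  proof (cases "s \<ge> 8 - r")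
    case True
    from \<open>\<not> r \<ge> 4\<close> assms consider "r = 1" | "r = 2" | "r = 3" by linarith
    thus ?thesis
      using gap_pos_small[of "real s - real (8 - r)"] True by cases auto
  next
    case s: False
    have "r \<in> {1, 2, 3}" "s \<in> {1, 2, 3, 4, 5, 6}" using s False assms by auto
    thus ?thesis by (auto simp: gap_def edge_numer_def both_numer_def)
  qed
qed

lemma ratio_4_4: "ratio 4 4 = 78100 / 77841"
  by (simp add: ratio_eq edge_numer_def both_numer_def)

lemma ratio_less:
  fixes r s :: nat
  assumes "r \<ge> 1" "s \<ge> 1" "\<not> (r = 4 \<and> s = 4)"
  shows "ratio (real r) (real s) < 78100 / 77841"
proof -
  have *: "ratio (real r) (real s) < 78100 / 77841"
    if "r \<ge> 1" "r \<le> s" "\<not> (r = 4 \<and> s = 4)" for r s :: nat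
  proof -
    have pos: "real r > 0" "real s > 0" using that by auto
    have "edge_numer (real r) (real s) * edge_numer (real s) (real r) > 0"
      using pos by (simp add: edge_numer_pos)
    thus ?thesis
      using gap_pos[OF that] unfolding ratio_eq[OF pos] gap_def
      by (simp add: divide_less_eq field_simps)
  qed
  show ?thesis
    using *[of r s] *[of s r] assms ratio_commute[of "real r" "real s"] by (cases "r \<le> s") auto
qed

section \<open>The symmetric subfamily\<close>

lemma ratio_diagonal:
  assumes "t > 0"
  shows "ratio t t = (t + 1)^2 * (t + 4) * (2 * t + 3) * (2 * t^2 + 19 * t + 34) /
    (2 * t^3 + 17 * t^2 + 34 * t + 22)^2"
proof -
  \<comment> \<open>On the diagonal each \<open>edge_numer\<close> has the factor
    \<open>4 * (t + 2)\<close>, whose square divides the other product and cancels.\<close>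
  have "edge_numer t t = (4 * (t + 2)) * (2 * t^3 + 17 * t^2 + 34 * t + 22)"
    unfolding edge_numer_def by algebra
  moreover have "both_numer t t * ((t + t + 2)^2 * (t + t + 3) * (t + t + 4)) =
      (4 * (t + 2))^2 * ((t + 1)^2 * (t + 4) * (2 * t + 3) * (2 * t^2 + 19 * t + 34))"
    unfolding both_numer_def by algebra
  moreover have "(c^2 * N) / ((c * D) * (c * D)) = N / D^2" if "c \<noteq> 0" for c N D :: real
    using that by (simp add: power2_eq_square)
  ultimately show ?thesis
    using assms by (simp only: ratio_eq) simp
qed

lemma ratio_diagonal_minus_1:
  assumes "t > 0"
  shows "ratio t t - 1 = (20 * t^3 + 9 * t^2 - 78 * t - 76) / (2 * t^3 + 17 * t^2 + 34 * t + 22)^2"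
proof -
  have "2 * t^3 + 17 * t^2 + 34 * t + 22 > 0"
    using assms by (intro add_pos_pos mult_pos_pos) auto
  hence "ratio t t - 1 = ((t + 1)^2 * (t + 4) * (2 * t + 3) * (2 * t^2 + 19 * t + 34) -
      (2 * t^3 + 17 * t^2 + 34 * t + 22)^2) / (2 * t^3 + 17 * t^2 + 34 * t + 22)^2"
    unfolding ratio_diagonal[OF assms] by (simp add: diff_divide_distrib)
  also have "(t + 1)^2 * (t + 4) * (2 * t + 3) * (2 * t^2 + 19 * t + 34) -
      (2 * t^3 + 17 * t^2 + 34 * t + 22)^2 = 20 * t^3 + 9 * t^2 - 78 * t - 76"
    by algebra
  finally show ?thesis .
qed

text \<open>The leading terms 20 t^3 and (2 t^3)^2 give the main term 5/t^3.\<close>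

lemma ratio_diagonal_bigo:
  "(\<lambda>t::nat. ratio (real t) (real t) - 1 - 5 / real t^3) \<in> O(\<lambda>t. 1 / real t^4)"
proof -
  have "eventually (\<lambda>t::nat. (20 * real t^3 + 9 * real t^2 - 78 * real t - 76) /
      (2 * real t^3 + 17 * real t^2 + 34 * real t + 22)^2 - 5 / real t^3 =
      ratio (real t) (real t) - 1 - 5 / real t^3) sequentially"
    using eventually_gt_at_top[of 0] by eventually_elim (simp add: ratio_diagonal_minus_1)
  moreover have "(\<lambda>t::nat. (20 * real t^3 + 9 * real t^2 - 78 * real t - 76) /
      (2 * real t^3 + 17 * real t^2 + 34 * real t + 22)^2 - 5 / real t^3) \<in> O(\<lambda>t. 1 / real t^4)"
    by real_asymp
  ultimately show ?thesis by (rule landau_o.big.in_cong[THEN iffD1])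
qed

lemma ratio_diagonal_tendsto: "(\<lambda>t::nat. ratio (real t) (real t)) \<longlonglongrightarrow> 1"
proof -
  have "eventually (\<lambda>t::nat. 1 + (20 * real t^3 + 9 * real t^2 - 78 * real t - 76) /
      (2 * real t^3 + 17 * real t^2 + 34 * real t + 22)^2 = ratio (real t) (real t)) sequentially"
    using eventually_gt_at_top[of 0] by eventually_elim (simp flip: ratio_diagonal_minus_1)
  moreover have "(\<lambda>t::nat. 1 + (20 * real t^3 + 9 * real t^2 - 78 * real t - 76) /
      (2 * real t^3 + 17 * real t^2 + 34 * real t + 22)^2) \<longlonglongrightarrow> 1"
    by real_asymp
  ultimately show ?thesis by (rule Lim_transform_eventually[rotated])
qed

section \<open>From random weights to the rational function\<close>

lemma (in K4_weights) mst_ratio_eq: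
  assumes e: "e \<in> edges_G r s" "fst e = {Va, Vb}" and f: "f \<in> edges_G r s" "fst f = {Vc, Vd}"
  shows "mst_ratio M r s X e f = ratio (real r) (real s)"
proof -
  let ?T = "\<lambda>\<omega>. mst_G r s (\<lambda>x. X x \<omega>)"
  have d: "distinct [Va, Vb, Vc, Vd]" "distinct [Vc, Vd, Va, Vb]" by simp_all
  have cl: "{{Va, Vb}, {Vc, Vd}} = {{Va, Vb}, {Vc, Vd}}" "{{Vc, Vd}, {Va, Vb}} = {{Va, Vb}, {Vc, Vd}}"
    by auto
  have m: "multiplicity_G r s {Va, Vb} = r" "multiplicity_G r s {Vc, Vd} = s"
    by (auto simp: multiplicity_G_def doubleton_eq_iff)
  have pe: "prob {\<omega> \<in> space M. e \<in> ?T \<omega>} = edge_prob (real r) (real s)"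
    using prob_mem_mst[OF d(1) cl(1) e] by (simp add: edge_prob_def m add_ac)
  have pf: "prob {\<omega> \<in> space M. f \<in> ?T \<omega>} = edge_prob (real s) (real r)"
    using prob_mem_mst[OF d(2) cl(2) f] by (simp add: edge_prob_def m add_ac)
  have le: "prob {\<omega> \<in> space M. e \<in> ?T \<omega> \<and> f \<in> ?T \<omega> \<and> X f \<omega> < X e \<omega>} =
      both_prob_less (real r) (real s)"
    using prob_mem_mst_both_less[OF d(1) cl(1) e f] by (simp add: both_prob_less_def m add_ac)
  have lf: "prob {\<omega> \<in> space M. f \<in> ?T \<omega> \<and> e \<in> ?T \<omega> \<and> X e \<omega> < X f \<omega>} =
      both_prob_less (real s) (real r)"
    using prob_mem_mst_both_less[OF d(2) cl(2) f e] by (simp add: both_prob_less_def m add_ac)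
  let ?A = "{\<omega> \<in> space M. e \<in> ?T \<omega> \<and> f \<in> ?T \<omega> \<and> X f \<omega> < X e \<omega>}"
    and ?B = "{\<omega> \<in> space M. f \<in> ?T \<omega> \<and> e \<in> ?T \<omega> \<and> X e \<omega> < X f \<omega>}"
  have AB: "?A \<in> events" "?B \<in> events"
    using e f by (intro sets.sets_Collect_conj sets_mem_mst borel_measurable_less measurable_X; simp)+
  \<comment> \<open>Ties between these two edges form a null set, so the two orders exhaust the
    joint event.\<close>
  have "e \<noteq> f" using e f by (auto simp: doubleton_eq_iff)
  have "prob {\<omega> \<in> space M. e \<in> ?T \<omega> \<and> f \<in> ?T \<omega>} = prob (?A \<union> ?B)"
  proof (rule finite_measure_eq_AE)
    show "AE \<omega> in M. (\<omega> \<in> {\<omega> \<in> space M. e \<in> ?T \<omega> \<and> f \<in> ?T \<omega>}) = (\<omega> \<in> ?A \<union> ?B)"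
      using AE_weights_neq[OF e(1) f(1) \<open>e \<noteq> f\<close>] by eventually_elim auto
    show "{\<omega> \<in> space M. e \<in> ?T \<omega> \<and> f \<in> ?T \<omega>} \<in> events"
      by (intro sets.sets_Collect_conj sets_mem_mst)
  qed (use AB in auto)
  also have "\<dots> = prob ?A + prob ?B"
    by (rule finite_measure_Union) (use AB in auto)
  finally have "prob {\<omega> \<in> space M. e \<in> ?T \<omega> \<and> f \<in> ?T \<omega>} =
      both_prob_less (real r) (real s) + both_prob_less (real s) (real r)"
    by (simp only: le lf)
  thus ?thesis by (simp add: mst_ratio_def Let_def ratio_def pe pf)
qed

lemma (in K4_weights) AE_ex1_is_mst:
  "AE \<omega> in M. \<exists>!T. is_mst_G r s (\<lambda>x. X x \<omega>) T"
  using AE_inj_on_weights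
  by eventually_elim (rule multigraph.ex1_is_mst[OF multigraph_edges_G[OF r_pos s_pos]])

lemma K4_weightsI:
  assumes "r \<ge> 1" "s \<ge> 1" "iid_atomless M (edges_G r s) X"
  shows "K4_weights M r s X"
proof -
  interpret prob_space M using assms by (simp add: iid_atomless_def)
  have "({Va, Vb}, 0) \<in> edges_G r s"
    using assms by (simp add: edges_G_def K4_edges_def multiplicity_G_def)
  with assms finite_edges_G show ?thesis by unfold_locales auto
qed

theorem proposition4p2:
  fixes M :: "nat \<Rightarrow> nat \<Rightarrow> 'w measure"
    and X :: "nat \<Rightarrow> nat \<Rightarrow> vertex set \<times> nat \<Rightarrow> 'w \<Rightarrow> real"
    and e f :: "nat \<Rightarrow> nat \<Rightarrow> vertex set \<times> nat"
    and R :: "nat \<Rightarrow> nat \<Rightarrow> real"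
  assumes weights: "\<And>r s. r \<ge> 1 \<Longrightarrow> s \<ge> 1 \<Longrightarrow> iid_atomless (M r s) (edges_G r s) (X r s)"
    and e_copy: "\<And>r s. r \<ge> 1 \<Longrightarrow> s \<ge> 1 \<Longrightarrow> e r s \<in> edges_G r s \<and> fst (e r s) = {Va, Vb}"
    and f_copy: "\<And>r s. r \<ge> 1 \<Longrightarrow> s \<ge> 1 \<Longrightarrow> f r s \<in> edges_G r s \<and> fst (f r s) = {Vc, Vd}"
    and R_eq: "\<And>r s. r \<ge> 1 \<Longrightarrow> s \<ge> 1 \<Longrightarrow> R r s = mst_ratio (M r s) r s (X r s) (e r s) (f r s)"
  shows "(\<forall>r\<ge>1. \<forall>s\<ge>1. AE \<omega> in M r s. \<exists>!T. is_mst_G r s (\<lambda>x. X r s x \<omega>) T) \<and>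
    (\<forall>r\<ge>1. \<forall>s\<ge>1. R r s \<le> 78100 / 77841) \<and>
    (1.003327::real) \<le> 78100 / 77841 \<and> (78100 / 77841 :: real) < 1.003328 \<and>
    (\<forall>r\<ge>1. \<forall>s\<ge>1. R r s = 78100 / 77841 \<longleftrightarrow> r = 4 \<and> s = 4) \<and>
    (\<forall>t\<ge>1. R t t =
       (real t + 1)^2 * (real t + 4) * (2 * real t + 3) * (2 * real t^2 + 19 * real t + 34) /
       (2 * real t^3 + 17 * real t^2 + 34 * real t + 22)^2) \<and>
    (\<forall>t\<ge>1. R t t - 1 =
       (20 * real t^3 + 9 * real t^2 - 78 * real t - 76) /
       (2 * real t^3 + 17 * real t^2 + 34 * real t + 22)^2) \<and>
    (\<lambda>t. R t t - 1 - 5 / real t^3) \<in> O(\<lambda>t. 1 / real t^4) \<and>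
    (\<forall>t\<ge>1. R t t \<le> R 4 4) \<and>
    (\<lambda>t. R t t) \<longlonglongrightarrow> 1 \<and>
    R 3 3 = 109872 / 109561"
proof -
  have K4: "K4_weights (M r s) r s (X r s)" if "r \<ge> 1" "s \<ge> 1" for r s
    using K4_weightsI weights that by blast
  have R: "R r s = ratio (real r) (real s)" if "r \<ge> 1" "s \<ge> 1" for r s
    using K4_weights.mst_ratio_eq[OF K4[OF that]] e_copy[OF that] f_copy[OF that] R_eq[OF that]
    by simp
  have R44: "R 4 4 = 78100 / 77841" using R[of 4 4] ratio_4_4 by simp
  have less: "R r s < 78100 / 77841" if "r \<ge> 1" "s \<ge> 1" "\<not> (r = 4 \<and> s = 4)" for r s
    using ratio_less[OF that] R that by simp
  have le: "R r s \<le> 78100 / 77841" if "r \<ge> 1" "s \<ge> 1" for r s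
    using less[OF that] R44 by (cases "r = 4 \<and> s = 4") auto
  \<comment> \<open>\<open>R\<close> is specified only for positive arguments, so asymptotic
    statements are transferred from \<open>t = 1\<close> on.\<close>
  have ev: "eventually (\<lambda>t. R t t = ratio (real t) (real t)) sequentially"
    using eventually_ge_at_top[of 1] by eventually_elim (rule R)
  show ?thesis
  proof (intro conjI allI impI)
    show "AE \<omega> in M r s. \<exists>!T. is_mst_G r s (\<lambda>x. X r s x \<omega>) T" if "r \<ge> 1" "s \<ge> 1" for r s
      using K4_weights.AE_ex1_is_mst[OF K4[OF that]] .
    show "R r s \<le> 78100 / 77841" if "r \<ge> 1" "s \<ge> 1" for r s
      using le that .
    show "R r s = 78100 / 77841 \<longleftrightarrow> r = 4 \<and> s = 4" if "r \<ge> 1" "s \<ge> 1" for r s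
      using less[OF that] R44 by fastforce
    fix t :: nat assume t: "t \<ge> 1"
    show "R t t = (real t + 1)^2 * (real t + 4) * (2 * real t + 3) * (2 * real t^2 + 19 * real t + 34) /
       (2 * real t^3 + 17 * real t^2 + 34 * real t + 22)^2"
      using R[OF t t] ratio_diagonal[of "real t"] t by simp
    show "R t t - 1 = (20 * real t^3 + 9 * real t^2 - 78 * real t - 76) /
       (2 * real t^3 + 17 * real t^2 + 34 * real t + 22)^2"
      using R[OF t t] ratio_diagonal_minus_1[of "real t"] t by simp
    show "R t t \<le> R 4 4" using le[OF t t] R44 by simp
  next
    have "eventually (\<lambda>t. ratio (real t) (real t) - 1 - 5 / real t^3 = R t t - 1 - 5 / real t^3) sequentially"
      using ev by eventually_elim simp
    thus "(\<lambda>t. R t t - 1 - 5 / real t^3) \<in> O(\<lambda>t. 1 / real t^4)"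
      using ratio_diagonal_bigo by (rule landau_o.big.in_cong[THEN iffD1])
    have "eventually (\<lambda>t. ratio (real t) (real t) = R t t) sequentially"
      using ev by eventually_elim simp
    with ratio_diagonal_tendsto show "(\<lambda>t. R t t) \<longlonglongrightarrow> 1"
      by (rule Lim_transform_eventually)
    show "R 3 3 = 109872 / 109561"
      using R[of 3 3] ratio_diagonal[of 3] by simp
  qed simp_all
qed

end
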